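(* Let $n\in\mathbb{N}$, let $\mathcal{C}$ be a submonoid of $\mathbb{N}_0^n(+)$, and let $R$ be a ring that is a factor (quotient ring) of the monoid ring $\mathbb{Z}[\mathcal{C}]$. Then $R$ cannot contain, as its subring, (a copy of) any non-finitely generated subring of $\mathbb{Q}$.
   Context: $\mathbb{N}_0^n$ is the set of $n$-tuples of non-negative integers. For $\alpha=(a_1,\dots,a_n)\in\mathbb{N}_0^n$ put $\boldsymbol{x}^\alpha=x_1^{a_1}\cdots x_n^{a_n}$; for a submonoid $\mathcal{C}$ of $\mathbb{N}_0^n(+)$, $\mathbb{Z}[\mathcal{C}]$ is the subring of $\mathbb{Z}[x_1,\dots,x_n]$ generated by the monomials $\boldsymbol{x}^\alpha$, $\alpha\in\mathcal{C}$. Subrings are not required to contain the unity of the ambient ring (so, e.g., $n\mathbb{Z}$ is a subring of $\mathbb{Q}$), and a ring is finitely generated if it is generated as a (not necessarily unital) ring by a finite subset. *)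

theory Defs
  imports "HOL-Algebra.Algebra" "HOL-Algebra.Algebraic_Closure_Type" "HOL-Library.Poly_Mapping"
begin

text \<open>
  Subrings need not contain the unity of the ambient ring (and if they have a unity of their own,
  it may be a different element), so the library's \<open>subring\<close>, \<open>generate_ring\<close> and \<open>ring_iso\<close>
  do not apply. In the following definitions the field \<open>one\<close> of a ring record is never used; in
  particular \<open>A\<lparr>carrier := K\<rparr>\<close> is a not necessarily unital ring whenever \<open>K\<close> is a subring of \<open>A\<close>.
\<close>

locale subrng = additive_subgroup K A for K and A (structure) +
  assumes mult_closed: "\<lbrakk>x \<in> K; y \<in> K\<rbrakk> \<Longrightarrow> x \<otimes> y \<in> K"

definition generate_subrng :: "('a, 'b) ring_scheme \<Rightarrow> 'a set \<Rightarrow> 'a set" where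
  "generate_subrng A H = \<Inter> {K. subrng K A \<and> H \<subseteq> K}"

definition finitely_generated_rng :: "('a, 'b) ring_scheme \<Rightarrow> bool" where
  "finitely_generated_rng A \<longleftrightarrow>
     (\<exists>F. finite F \<and> F \<subseteq> carrier A \<and> generate_subrng A F = carrier A)"

definition rng_isomorphic :: "('a, 'b) ring_scheme \<Rightarrow> ('c, 'd) ring_scheme \<Rightarrow> bool" where
  "rng_isomorphic A B \<longleftrightarrow> (\<exists>h. h \<in> iso (add_monoid A) (add_monoid B) \<and> h \<in> iso A B)"

text \<open>
  The \<open>n\<close>-tuple \<open>(a\<^sub>1, \<dots>, a\<^sub>n)\<close> of non-negative integers is encoded as the finitely supported
  function with value \<open>a\<^sub>i\<^sub>+\<^sub>1\<close> at \<open>i < n\<close> and \<open>0\<close> elsewhere.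
\<close>

definition exponent_monoid :: "nat \<Rightarrow> (nat \<Rightarrow>\<^sub>0 nat) monoid" where
  "exponent_monoid n = \<lparr>carrier = {\<alpha>. Poly_Mapping.keys \<alpha> \<subseteq> {..<n}}, monoid.mult = (+), one = 0\<rparr>"

text \<open>
  The type \<open>(nat \<Rightarrow>\<^sub>0 nat) \<Rightarrow>\<^sub>0 int\<close>, whose library multiplication is convolution, is the ring of integer
  polynomials in countably many variables; \<open>\<int>[x\<^sub>1, \<dots>, x\<^sub>n]\<close> is cut out by the exponents that occur.
\<close>

definition int_mpoly_ring :: "nat \<Rightarrow> ((nat \<Rightarrow>\<^sub>0 nat) \<Rightarrow>\<^sub>0 int) ring" where
  "int_mpoly_ring n = ring_of_type_algebra
     \<lparr>carrier := {p. Poly_Mapping.keys p \<subseteq> carrier (exponent_monoid n)}\<rparr>"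

definition mvar :: "nat \<Rightarrow> (nat \<Rightarrow>\<^sub>0 nat) \<Rightarrow>\<^sub>0 int" where
  "mvar i = Poly_Mapping.single (Poly_Mapping.single i 1) 1"

definition monomial_of :: "nat \<Rightarrow> (nat \<Rightarrow>\<^sub>0 nat) \<Rightarrow> (nat \<Rightarrow>\<^sub>0 nat) \<Rightarrow>\<^sub>0 int" where
  "monomial_of n \<alpha> = (\<Prod>i<n. mvar i ^ Poly_Mapping.lookup \<alpha> i)"

definition int_monoid_ring :: "nat \<Rightarrow> (nat \<Rightarrow>\<^sub>0 nat) set \<Rightarrow> ((nat \<Rightarrow>\<^sub>0 nat) \<Rightarrow>\<^sub>0 int) ring" where
  "int_monoid_ring n C = int_mpoly_ring n
     \<lparr>carrier := generate_subrng (int_mpoly_ring n) (monomial_of n ` C)\<rparr>"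

abbreviation rat_ring :: "rat ring" where
  "rat_ring \<equiv> ring_of_type_algebra"

end

theory Submission
  imports Defs "HOL-Library.Function_Algebras"
begin

text \<open>
  Let \<open>S\<close> be a subring of \<open>\<rat>\<close> and \<open>k\<close> the least positive integer in \<open>S\<close>. If only finitely many primes
  divide denominators of elements of \<open>S\<close>, with product \<open>b\<close>, then \<open>S = k\<int>[1/b]\<close> is finitely generated.
  So if \<open>S\<close> is not finitely generated, it contains \<open>k/p\<close> for infinitely many primes \<open>p\<close>.

  Suppose a quotient \<open>R\<close> of \<open>D = \<int>[C]\<close> contains a copy of \<open>S\<close>. Its nonzero elements are closed under
  multiplication, so \<open>D\<close> has a prime ideal \<open>P\<close> that contains the kernel of \<open>D \<rightarrow> R\<close> and avoids their
  preimages; then \<open>P \<inter> \<int> = 0\<close>, and the image of \<open>k \<in> S\<close> in the domain \<open>D/P\<close> is the integer \<open>k\<close>, as it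
  is a nonzero root of \<open>X\<^sup>2 = kX\<close>. Hence infinitely many primes divide \<open>k\<close> in \<open>D/P\<close>.

  The exponents \<open>\<alpha> \<in> C\<close> with \<open>x\<^sup>\<alpha> \<notin> P\<close> span a subgroup of \<open>\<int>\<^sup>n\<close>, which is generated by finitely many of
  them. So although \<open>D/P\<close> may not be finitely generated, it lies in \<open>A[1/s]\<close>, where \<open>A\<close> is generated
  by the corresponding monomials and \<open>s \<in> A\<close> is their product. But in a finitely generated domain \<open>A\<close>
  of characteristic 0, a fixed nonzero element is nilpotent modulo \<open>p\<close> for only finitely many primes
  \<open>p\<close>. This is proved by adjoining one generator at a time, and it applies to \<open>ks\<close>.

  All computations in \<open>D/P\<close> are carried out as congruences modulo \<open>P\<close> in the ambient ring.
\<close>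

section \<open>Polynomials over subrings\<close>

locale unital_subring =
  fixes A :: "'a::comm_ring_1 set"
  assumes one_mem: "1 \<in> A"
    and diff_mem: "\<lbrakk>x \<in> A; y \<in> A\<rbrakk> \<Longrightarrow> x - y \<in> A"
    and mult_mem: "\<lbrakk>x \<in> A; y \<in> A\<rbrakk> \<Longrightarrow> x * y \<in> A"
begin

lemma zero_mem: "0 \<in> A"
  using diff_mem[OF one_mem one_mem] by simp

lemma uminus_mem: "x \<in> A \<Longrightarrow> - x \<in> A"
  using diff_mem[OF zero_mem] by fastforce

lemma add_mem: "\<lbrakk>x \<in> A; y \<in> A\<rbrakk> \<Longrightarrow> x + y \<in> A"
  using diff_mem[OF _ uminus_mem] by fastforce

lemma of_nat_mem: "of_nat n \<in> A"
  by (induction n) (auto intro: zero_mem one_mem add_mem)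

lemma of_int_mem: "of_int z \<in> A"
  by (cases z) (auto intro!: of_nat_mem uminus_mem add_mem diff_mem one_mem)

lemma power_mem: "x \<in> A \<Longrightarrow> x ^ m \<in> A"
  by (induction m) (auto intro: one_mem mult_mem)

lemma sum_mem: "(\<And>i. i \<in> J \<Longrightarrow> f i \<in> A) \<Longrightarrow> sum f J \<in> A"
  by (induction J rule: infinite_finite_induct) (auto intro: zero_mem add_mem)

lemma prod_mem: "(\<And>i. i \<in> J \<Longrightarrow> f i \<in> A) \<Longrightarrow> prod f J \<in> A"
  by (induction J rule: infinite_finite_induct) (auto intro: one_mem mult_mem)

end

definition polys_over :: "'a::comm_ring_1 set \<Rightarrow> 'a poly set" where
  "polys_over A = {f. \<forall>i. poly.coeff f i \<in> A}"

definition adjoin :: "'a::comm_ring_1 set \<Rightarrow> 'a \<Rightarrow> 'a set" where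
  "adjoin A y = (\<lambda>f. poly f y) ` polys_over A"

lemma polys_over_mono: "A \<subseteq> B \<Longrightarrow> polys_over A \<subseteq> polys_over B"
  by (auto simp: polys_over_def)

context unital_subring
begin

lemma polys_over_pCons: "\<lbrakk>c \<in> A; f \<in> polys_over A\<rbrakk> \<Longrightarrow> pCons c f \<in> polys_over A"
  by (auto simp: polys_over_def coeff_pCons split: nat.split)

lemma polys_over_0: "0 \<in> polys_over A"
  by (auto simp: polys_over_def intro: zero_mem)

lemma polys_over_const: "c \<in> A \<Longrightarrow> [:c:] \<in> polys_over A"
  by (intro polys_over_pCons polys_over_0)

lemma polys_over_monom: "c \<in> A \<Longrightarrow> Polynomial.monom c k \<in> polys_over A"
  by (auto simp: polys_over_def intro: zero_mem)

lemma polys_over_diff: "\<lbrakk>f \<in> polys_over A; g \<in> polys_over A\<rbrakk> \<Longrightarrow> f - g \<in> polys_over A"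
  by (auto simp: polys_over_def intro: diff_mem)

lemma polys_over_mult: "\<lbrakk>f \<in> polys_over A; g \<in> polys_over A\<rbrakk> \<Longrightarrow> f * g \<in> polys_over A"
  by (auto simp: polys_over_def coeff_mult intro!: sum_mem mult_mem)

lemma polys_over_smult: "\<lbrakk>c \<in> A; f \<in> polys_over A\<rbrakk> \<Longrightarrow> Polynomial.smult c f \<in> polys_over A"
  by (auto simp: polys_over_def intro!: mult_mem)

lemma polys_over_subring: "unital_subring (polys_over A)"
  using polys_over_const[OF one_mem]
  by unfold_locales (auto simp: one_pCons intro: polys_over_diff polys_over_mult)

lemma poly_mem: "\<lbrakk>f \<in> polys_over A; y \<in> A\<rbrakk> \<Longrightarrow> poly f y \<in> A"
  by (auto simp: polys_over_def poly_altdef intro!: sum_mem mult_mem power_mem)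

lemma adjoin_subring: "unital_subring (adjoin A y)"
proof -
  interpret polys: unital_subring "polys_over A" by (rule polys_over_subring)
  have "poly 1 y \<in> adjoin A y"
    unfolding adjoin_def by (rule imageI polys.one_mem)+
  moreover have "poly f y - poly g y \<in> adjoin A y" "poly f y * poly g y \<in> adjoin A y"
    if "f \<in> polys_over A" "g \<in> polys_over A" for f g
    using that polys.diff_mem polys.mult_mem unfolding adjoin_def
    by (auto simp flip: poly_diff poly_mult)
  ultimately show ?thesis
    by unfold_locales (auto simp: adjoin_def)
qed

lemma subset_adjoin: "A \<subseteq> adjoin A y"
proof
  fix c assume "c \<in> A"
  then have "poly [:c:] y \<in> adjoin A y"
    unfolding adjoin_def by (intro imageI polys_over_const)
  then show "c \<in> adjoin A y" by simp
qed

lemma generator_mem_adjoin: "y \<in> adjoin A y"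
proof -
  have "poly [:0, 1:] y \<in> adjoin A y"
    unfolding adjoin_def by (intro imageI polys_over_pCons polys_over_0 zero_mem one_mem)
  then show ?thesis by simp
qed

lemma adjoin_subset:
  assumes "unital_subring B" "A \<subseteq> B" "y \<in> B"
  shows "adjoin A y \<subseteq> B"
  using unital_subring.poly_mem[OF assms(1) subsetD[OF polys_over_mono[OF assms(2)]] assms(3)]
  by (auto simp: adjoin_def)

text \<open>Induction on the degree of \<open>F\<close>: multiplying by \<open>lead_coeff g\<close>
  before cancelling the top term avoids division in \<open>A\<close>. The degree bound on
  \<open>q\<close> later lets minimality be applied to quotients as well as remainders.\<close>

lemma pseudo_division:
  assumes "F \<in> polys_over A" "g \<in> polys_over A" "Polynomial.degree g > 0"
  shows "\<exists>M q r. q \<in> polys_over A \<and> r \<in> polys_over A \<and>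
           Polynomial.smult (lead_coeff g ^ M) F = q * g + r \<and>
           Polynomial.degree r < Polynomial.degree g \<and>
           Polynomial.degree q \<le> Polynomial.degree F - Polynomial.degree g"
  using assms(1)
proof (induction "Polynomial.degree F" arbitrary: F rule: less_induct)
  case less
  interpret polys: unital_subring "polys_over A" by (rule polys_over_subring)
  show ?case
  proof (cases "Polynomial.degree F < Polynomial.degree g")
    case True
    then show ?thesis
      by (intro exI[of _ 0] exI[of _ "0 :: 'a poly"] exI[of _ F]) (use less.prems polys.zero_mem in simp)
  next
    case False
    define e where "e = lead_coeff g"
    define k where "k = Polynomial.degree F - Polynomial.degree g"
    define G where "G = Polynomial.monom (lead_coeff F) k * g"
    define F' where "F' = Polynomial.smult e F - G"
    have e: "e \<in> A" and l: "lead_coeff F \<in> A"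
      using assms(2) less.prems by (auto simp: e_def polys_over_def)
    have F': "F' \<in> polys_over A"
      unfolding F'_def G_def
      by (intro polys_over_diff polys_over_smult polys_over_mult polys_over_monom e l assms less.prems)
    have deg: "Polynomial.degree F = k + Polynomial.degree g"
      using False by (simp add: k_def)
    have "Polynomial.degree G \<le> Polynomial.degree F"
      unfolding G_def deg
      by (meson add_mono degree_monom_le degree_mult_le dual_order.refl order_trans)
    then have "Polynomial.degree F' \<le> Polynomial.degree F"
      unfolding F'_def by (intro degree_diff_le degree_smult_le)
    moreover have "poly.coeff F' (Polynomial.degree F) = 0"
      by (simp add: F'_def G_def coeff_monom_mult e_def deg)
    ultimately have "F' = 0 \<or> Polynomial.degree F' < Polynomial.degree F"
      by (rule eq_zero_or_degree_less)
    then have F'less: "Polynomial.degree F' < Polynomial.degree F"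
      using False assms(3) by auto
    obtain M q r where qr: "q \<in> polys_over A" "r \<in> polys_over A"
      "Polynomial.smult (e ^ M) F' = q * g + r" "Polynomial.degree r < Polynomial.degree g"
      "Polynomial.degree q \<le> Polynomial.degree F' - Polynomial.degree g"
      using less.hyps[OF F'less F'] unfolding e_def by blast
    let ?q = "q + Polynomial.monom (e ^ M * lead_coeff F) k"
    have "Polynomial.smult (e ^ Suc M) F = Polynomial.smult (e ^ M) (F' + G)"
      by (simp add: F'_def mult.commute)
    also have "\<dots> = ?q * g + r"
      by (simp add: smult_add_right qr(3) G_def algebra_simps flip: smult_monom)
    finally have eq: "Polynomial.smult (e ^ Suc M) F = ?q * g + r" .
    have "?q \<in> polys_over A"
      by (intro polys.add_mem qr polys_over_monom mult_mem power_mem e l)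
    moreover have "Polynomial.degree ?q \<le> k"
      using qr(5) F'less by (intro degree_add_le degree_monom_le) (auto simp: k_def)
    ultimately show ?thesis
      using eq qr unfolding e_def k_def by blast
  qed
qed

end

section \<open>Elements that are not nilpotent modulo almost all primes\<close>

text \<open>Modulo \<open>P\<close> the ring \<open>D\<close> becomes an integral domain of
  characteristic 0. \<open>P_of_int\<close> gives both the characteristic and the properness of
  \<open>P\<close>, since \<open>1\<close> is an integer.\<close>

locale prime_mod = D: unital_subring D
  for D :: "'a::comm_ring_1 set" +
  fixes P :: "'a set"
  assumes P_diff: "\<lbrakk>x \<in> P; y \<in> P\<rbrakk> \<Longrightarrow> x - y \<in> P"
    and P_mult: "\<lbrakk>x \<in> D; y \<in> P\<rbrakk> \<Longrightarrow> x * y \<in> P"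
    and P_prime: "\<lbrakk>x \<in> D; y \<in> D; x * y \<in> P\<rbrakk> \<Longrightarrow> x \<in> P \<or> y \<in> P"
    and P_of_int: "of_int z \<in> P \<longleftrightarrow> z = 0"
begin

definition cong_mod (infix \<open>\<approx>\<^sub>P\<close> 50) where "x \<approx>\<^sub>P y \<longleftrightarrow> x - y \<in> P"

lemma P_0: "0 \<in> P"
  using P_of_int[of 0] by simp

lemma P_1: "1 \<notin> P"
  using P_of_int[of 1] by simp

lemma P_uminus: "x \<in> P \<Longrightarrow> - x \<in> P"
  using P_diff[OF P_0] by fastforce

lemma P_add: "\<lbrakk>x \<in> P; y \<in> P\<rbrakk> \<Longrightarrow> x + y \<in> P"
  using P_diff[OF _ P_uminus] by fastforce

lemma P_sum: "(\<And>i. i \<in> J \<Longrightarrow> f i \<in> P) \<Longrightarrow> sum f J \<in> P"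
  by (induction J rule: infinite_finite_induct) (auto intro: P_0 P_add)

lemma not_P_mult: "\<lbrakk>x \<in> D - P; y \<in> D - P\<rbrakk> \<Longrightarrow> x * y \<in> D - P"
  using P_prime D.mult_mem by blast

lemma not_P_power: "x \<in> D - P \<Longrightarrow> x ^ m \<in> D - P"
proof (induction m)
  case 0
  then show ?case using P_1 D.one_mem by simp
next
  case (Suc m)
  then show ?case using not_P_mult[of x "x ^ m"] by simp
qed

lemma not_P_prod: "(\<And>i. i \<in> J \<Longrightarrow> f i \<in> D - P) \<Longrightarrow> prod f J \<in> D - P"
proof (induction J rule: infinite_finite_induct)
  case (insert j J)
  then have "f j \<in> D - P" "prod f J \<in> D - P" by blast+
  then have "f j * prod f J \<in> D - P" by (rule not_P_mult)
  then show ?case using insert.hyps by simp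
qed (use P_1 D.one_mem in simp_all)

lemma cong_refl: "x \<approx>\<^sub>P x"
  by (simp add: cong_mod_def P_0)

lemma cong_sym: "x \<approx>\<^sub>P y \<Longrightarrow> y \<approx>\<^sub>P x"
  using P_uminus[of "x - y"] by (simp add: cong_mod_def)

lemma cong_trans [trans]: "\<lbrakk>x \<approx>\<^sub>P y; y \<approx>\<^sub>P z\<rbrakk> \<Longrightarrow> x \<approx>\<^sub>P z"
  using P_add[of "x - y" "y - z"] by (simp add: cong_mod_def)

lemma cong_diff: "\<lbrakk>x \<approx>\<^sub>P x'; y \<approx>\<^sub>P y'\<rbrakk> \<Longrightarrow> x - y \<approx>\<^sub>P x' - y'"
  using P_diff[of "x - x'" "y - y'"] by (simp add: cong_mod_def algebra_simps)

lemma cong_mult: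
  assumes "x \<approx>\<^sub>P x'" "y \<approx>\<^sub>P y'" "x \<in> D" "y' \<in> D"
  shows "x * y \<approx>\<^sub>P x' * y'"
proof -
  have "x * (y - y') + y' * (x - x') \<in> P"
    using assms by (auto simp: cong_mod_def intro: P_add P_mult)
  then show ?thesis
    by (simp add: cong_mod_def algebra_simps)
qed

lemma cong_mult_left: "\<lbrakk>y \<approx>\<^sub>P y'; x \<in> D\<rbrakk> \<Longrightarrow> x * y \<approx>\<^sub>P x * y'"
  using P_mult[of x "y - y'"] by (simp add: cong_mod_def algebra_simps)

lemma cong_power: "\<lbrakk>x \<approx>\<^sub>P y; x \<in> D; y \<in> D\<rbrakk> \<Longrightarrow> x ^ m \<approx>\<^sub>P y ^ m"
proof (induction m)
  case (Suc m)
  then show ?case using cong_mult[of x y "x ^ m" "y ^ m"] D.power_mem by simp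
qed (simp add: cong_refl)

lemma cong_P: "x \<approx>\<^sub>P y \<Longrightarrow> x \<in> P \<longleftrightarrow> y \<in> P"
  using P_add[of "x - y" y] P_diff[of x "x - y"] by (auto simp: cong_mod_def)

lemma cong_0: "x \<approx>\<^sub>P 0 \<longleftrightarrow> x \<in> P"
  by (simp add: cong_mod_def)

lemma cong_D: "\<lbrakk>x - y = z; z \<in> P\<rbrakk> \<Longrightarrow> x \<approx>\<^sub>P y"
  by (simp add: cong_mod_def)

section \<open>Polynomials with coefficients modulo \<open>P\<close>\<close>

lemma poly_in_P:
  assumes "\<And>i. poly.coeff f i \<in> P" "y \<in> D"
  shows "poly f y \<in> P"
  unfolding poly_altdef
proof (rule P_sum)
  fix i
  show "poly.coeff f i * y ^ i \<in> P"
    using P_mult[OF D.power_mem[OF assms(2)] assms(1)] by (simp add: mult.commute)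
qed

text \<open>Modulo \<open>P\<close> the leading coefficient of \<open>f\<close> may vanish. Cutting
  \<open>f\<close> off above its last coefficient outside \<open>P\<close> removes only coefficients
  in \<open>P\<close>, and leaves the true degree modulo \<open>P\<close>.\<close>

lemma lead_coeff_not_in_P:
  assumes "f \<in> polys_over A" "0 \<in> A" "poly.coeff f j \<notin> P"
  shows "\<exists>g \<in> polys_over A. Polynomial.degree g \<le> Polynomial.degree f \<and> lead_coeff g \<notin> P \<and>
           (\<forall>i. poly.coeff g i \<approx>\<^sub>P poly.coeff f i)"
proof -
  define m where "m = (GREATEST i. poly.coeff f i \<notin> P)"
  have bound: "i \<le> Polynomial.degree f" if "poly.coeff f i \<notin> P" for i
    using that P_0 by (auto intro: le_degree)
  have m: "poly.coeff f m \<notin> P"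
    unfolding m_def by (rule GreatestI_nat[of _ j "Polynomial.degree f"]) (use assms(3) bound in auto)
  have m_max: "i \<le> m" if "poly.coeff f i \<notin> P" for i
    unfolding m_def by (rule Greatest_le_nat[of _ i "Polynomial.degree f"]) (use that bound in auto)
  define g where "g = poly_cutoff (Suc m) f"
  have c: "poly.coeff g i = (if i \<le> m then poly.coeff f i else 0)" for i
    by (auto simp: g_def coeff_poly_cutoff)
  have "poly.coeff f m \<noteq> 0"
    using m P_0 by auto
  then have deg: "Polynomial.degree g = m"
    by (intro order.antisym degree_le le_degree) (auto simp: c)
  have "g \<in> polys_over A"
    using assms(1,2) by (auto simp: polys_over_def c)
  moreover have "poly.coeff g i \<approx>\<^sub>P poly.coeff f i" for i
    using m_max[of i] cong_sym[of "poly.coeff f i" 0] by (auto simp: c cong_refl cong_0)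
  ultimately show ?thesis
    using m bound[OF m] unfolding deg[symmetric] by (intro bexI[of _ g] conjI allI) (simp_all add: c deg)
qed

lemma poly_cong:
  assumes "\<And>i. poly.coeff g i \<approx>\<^sub>P poly.coeff f i" "y \<in> D"
  shows "poly g y \<approx>\<^sub>P poly f y"
  using poly_in_P[of "g - f" y] assms by (simp add: cong_mod_def)

text \<open>In \<open>A\<close> modulo \<open>P\<close>, each nonzero element is nilpotent modulo
  \<open>p\<close> for only finitely many primes \<open>p\<close>; \<open>N\<close> encodes the
  exceptional primes as its divisors. The cofactor \<open>c\<close> must lie in \<open>A\<close>,
  not merely in \<open>D\<close>, so the property has to be re-established whenever \<open>A\<close>
  grows.\<close>

definition persistent :: "'a set \<Rightarrow> bool" where
  "persistent A \<longleftrightarrow> (\<forall>a\<in>A - P. \<exists>N>0. \<forall>p m. Factorial_Ring.prime p \<longrightarrow> \<not> p dvd N \<longrightarrow>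
     (\<forall>c\<in>A. \<not> a ^ m \<approx>\<^sub>P of_nat p * c))"

lemma persistentE:
  assumes "persistent A" "a \<in> A - P"
  obtains N :: nat where "N > 0"
    "\<And>p m c. \<lbrakk>Factorial_Ring.prime p; \<not> p dvd N; c \<in> A\<rbrakk> \<Longrightarrow> \<not> a ^ m \<approx>\<^sub>P of_nat p * c"
proof -
  obtain N :: nat where "N > 0" and N: "\<forall>p m. Factorial_Ring.prime p \<longrightarrow> \<not> p dvd N \<longrightarrow>
      (\<forall>c\<in>A. \<not> a ^ m \<approx>\<^sub>P of_nat p * c)"
    using bspec[OF assms(1)[unfolded persistent_def] assms(2)] by (elim exE conjE)
  then show thesis
    using that[OF \<open>N > 0\<close>] by simp
qed

lemma persistent_ints: "persistent (range of_int)"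
  unfolding persistent_def
proof (intro ballI)
  fix a :: 'a assume "a \<in> range of_int - P"
  then obtain z where z: "a = of_int z" "z \<noteq> 0"
    using P_of_int by blast
  show "\<exists>N>0. \<forall>p m. Factorial_Ring.prime p \<longrightarrow> \<not> p dvd N \<longrightarrow>
          (\<forall>c\<in>range of_int. \<not> a ^ m \<approx>\<^sub>P of_nat p * c)"
  proof (intro exI[of _ "nat \<bar>z\<bar>"] conjI allI impI ballI notI)
    fix p m c
    assume p: "Factorial_Ring.prime p" "\<not> p dvd nat \<bar>z\<bar>"
      and c: "c \<in> range of_int" "a ^ m \<approx>\<^sub>P of_nat p * c"
    from c(1) obtain w where "c = of_int w" by auto
    with c(2) have "of_int (z ^ m - int p * w) \<in> P"
      by (simp add: cong_mod_def z)
    then have "z ^ m = int p * w"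
      unfolding P_of_int by simp
    then have "int p dvd z ^ m" by simp
    then have "int p dvd z"
      using p(1) prime_dvd_power[of "int p" z m] by simp
    then have "int p dvd int (nat \<bar>z\<bar>)" by simp
    then show False
      using p(2) unfolding of_nat_dvd_iff by simp
  qed (use z in auto)
qed

text \<open>Formulated with a coefficient because zero divisors may push the degree of
  \<open>f ^ m\<close> below \<open>m * degree f\<close>; both sides are 0 in that case.\<close>

lemma coeff_power_top:
  fixes f :: "'a poly"
  shows "poly.coeff (f ^ m) (m * Polynomial.degree f) = lead_coeff f ^ m"
proof (induction m)
  case (Suc m)
  have "poly.coeff (f * f ^ m) (Polynomial.degree f + m * Polynomial.degree f)
      = lead_coeff f * poly.coeff (f ^ m) (m * Polynomial.degree f)"
  proof (cases "Polynomial.degree (f ^ m) = m * Polynomial.degree f")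
    case True
    then show ?thesis
      using coeff_mult_degree_sum[of f "f ^ m"] by simp
  next
    case False
    then have "Polynomial.degree (f ^ m) < m * Polynomial.degree f"
      using degree_power_le[of f m] by (simp add: mult.commute)
    moreover from this have "Polynomial.degree (f * f ^ m) < Polynomial.degree f + m * Polynomial.degree f"
      using degree_mult_le[of f "f ^ m"] by linarith
    ultimately show ?thesis
      by (simp add: coeff_eq_0)
  qed
  then show ?case
    using Suc by simp
qed simp

text \<open>Congruences between values at \<open>y\<close> may be compared coefficientwise. In
  degree \<open>m * degree f\<close> the comparison makes \<open>p\<close> divide a power of
  \<open>lead_coeff f\<close>, so the \<open>N\<close> of that coefficient serves for
  \<open>b\<close>.\<close>

lemma persistent_adjoin_transcendental:
  assumes "unital_subring A" "A \<subseteq> D" "y \<in> D" "persistent A"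
    and transcendental: "\<And>f i. \<lbrakk>f \<in> polys_over A; poly f y \<in> P\<rbrakk> \<Longrightarrow> poly.coeff f i \<in> P"
  shows "persistent (adjoin A y)"
  unfolding persistent_def
proof (intro ballI)
  interpret A: unital_subring A by fact
  interpret polys: unital_subring "polys_over A" by (rule A.polys_over_subring)
  fix b assume b: "b \<in> adjoin A y - P"
  then obtain f0 where f0: "f0 \<in> polys_over A" "b = poly f0 y"
    by (auto simp: adjoin_def)
  then obtain j where "poly.coeff f0 j \<notin> P"
    using poly_in_P[of f0 y] b assms(3) by auto
  then obtain f where f: "f \<in> polys_over A" "lead_coeff f \<notin> P" "\<And>i. poly.coeff f i \<approx>\<^sub>P poly.coeff f0 i"
    using lead_coeff_not_in_P[OF f0(1) A.zero_mem] by blast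
  have fb: "poly f y \<approx>\<^sub>P b"
    unfolding f0(2) by (rule poly_cong[OF f(3) assms(3)])
  have D: "poly g y \<in> D" if "g \<in> polys_over A" for g
    using that assms(2,3) polys_over_mono D.poly_mem by blast
  have "lead_coeff f \<in> A - P"
    using f(1,2) by (auto simp: polys_over_def)
  then obtain N :: nat where N: "N > 0"
    "\<And>p m c. \<lbrakk>Factorial_Ring.prime p; \<not> p dvd N; c \<in> A\<rbrakk> \<Longrightarrow> \<not> lead_coeff f ^ m \<approx>\<^sub>P of_nat p * c"
    by (rule persistentE[OF assms(4)]) blast
  show "\<exists>N>0. \<forall>p m. Factorial_Ring.prime p \<longrightarrow> \<not> p dvd N \<longrightarrow>
          (\<forall>c\<in>adjoin A y. \<not> b ^ m \<approx>\<^sub>P of_nat p * c)"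
  proof (intro exI[of _ N] conjI allI impI ballI notI N(1))
    fix p m c
    assume p: "Factorial_Ring.prime p" "\<not> p dvd N" and c: "c \<in> adjoin A y" "b ^ m \<approx>\<^sub>P of_nat p * c"
    obtain g where g: "g \<in> polys_over A" "c = poly g y"
      using c(1) by (auto simp: adjoin_def)
    define F where "F = f ^ m - of_nat p * g"
    have F: "F \<in> polys_over A"
      unfolding F_def by (intro polys.diff_mem polys.mult_mem polys.power_mem polys.of_nat_mem f g)
    have "poly f y ^ m \<approx>\<^sub>P b ^ m"
      using fb D f(1) f0 by (intro cong_power) auto
    then have "poly f y ^ m \<approx>\<^sub>P of_nat p * c"
      using c(2) cong_trans by blast
    then have "poly F y \<in> P"
      by (simp add: F_def cong_mod_def g(2))
    then have "poly.coeff F (m * Polynomial.degree f) \<in> P"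
      by (rule transcendental[OF F])
    then have "lead_coeff f ^ m \<approx>\<^sub>P of_nat p * poly.coeff g (m * Polynomial.degree f)"
      by (simp add: F_def cong_mod_def coeff_power_top of_nat_poly)
    then show False
      using N(2)[OF p] g(1) by (auto simp: polys_over_def)
  qed
qed

text \<open>Over the fraction field of \<open>A\<close> modulo \<open>P\<close> the polynomial \<open>f\<close> is the minimal polynomial
  of \<open>y\<close>, so that Euclid's algorithm applied to \<open>f\<close> and \<open>g\<close> inverts \<open>g(y)\<close> up to an element of \<open>A\<close>.\<close>

lemma divides_constant:
  assumes "unital_subring A" "A \<subseteq> D" "y \<in> D"
    and f: "f \<in> polys_over A" "poly f y \<in> P" "lead_coeff f \<notin> P"
    and minimal: "\<And>g i. \<lbrakk>g \<in> polys_over A; poly g y \<in> P; Polynomial.degree g < Polynomial.degree f\<rbrakk>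
                    \<Longrightarrow> poly.coeff g i \<in> P"
    and g: "g \<in> polys_over A" "poly g y \<notin> P" "Polynomial.degree g < Polynomial.degree f"
  shows "\<exists>b \<in> adjoin A y. \<exists>a \<in> A - P. b * poly g y \<approx>\<^sub>P a"
  using g
proof (induction "Polynomial.degree g" arbitrary: g rule: less_induct)
  case less
  interpret A: unital_subring A by fact
  interpret polys: unital_subring "polys_over A" by (rule A.polys_over_subring)
  interpret B: unital_subring "adjoin A y" by (rule A.adjoin_subring)
  have D: "poly h y \<in> D" if "h \<in> polys_over A" for h
    using that assms(2,3) polys_over_mono D.poly_mem by blast
  have B: "poly h y \<in> adjoin A y" if "h \<in> polys_over A" for h
    using that by (auto simp: adjoin_def)
  obtain j where "poly.coeff g j \<notin> P"
    using poly_in_P[of g y] less.prems(2) assms(3) by auto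
  then obtain g' where g': "g' \<in> polys_over A" "lead_coeff g' \<notin> P" "Polynomial.degree g' \<le> Polynomial.degree g"
    "\<And>i. poly.coeff g' i \<approx>\<^sub>P poly.coeff g i"
    using lead_coeff_not_in_P[OF less.prems(1) A.zero_mem] by blast
  have gg: "poly g y \<approx>\<^sub>P poly g' y"
    by (rule cong_sym[OF poly_cong[OF g'(4) assms(3)]])
  then have g'P: "poly g' y \<notin> P"
    using cong_P less.prems(2) by blast
  show ?case
  proof (cases "Polynomial.degree g' = 0")
    case True
    then obtain a where "g' = [:a:]"
      by (rule degree_eq_zeroE)
    then have "1 * poly g y \<approx>\<^sub>P a" "a \<in> A - P"
      using gg g' by (auto simp: polys_over_def coeff_pCons split: nat.splits)
    then show ?thesis
      using B.one_mem by blast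
  next
    case False
    then obtain M q r where q: "q \<in> polys_over A" and r: "r \<in> polys_over A"
      and eq: "Polynomial.smult (lead_coeff g' ^ M) f = q * g' + r"
      and deg_r: "Polynomial.degree r < Polynomial.degree g'"
      and deg_q: "Polynomial.degree q \<le> Polynomial.degree f - Polynomial.degree g'"
      using A.pseudo_division[OF f(1) g'(1)] by auto
    define e where "e = lead_coeff g'"
    have e: "e \<in> D - P"
      using g' assms(2) by (auto simp: e_def polys_over_def)
    have eq_y: "e ^ M * poly f y = poly q y * poly g' y + poly r y"
      using arg_cong[OF eq, of "\<lambda>h. poly h y"] by (simp add: e_def)
    have lhs: "e ^ M * poly f y \<in> P"
      using P_mult[OF _ f(2)] D.power_mem e by blast
    \<comment> \<open>Otherwise \<open>q(y)\<close> lies in \<open>P\<close>, since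
      \<open>g'(y)\<close> does not, and by minimality all coefficients of \<open>q\<close> and
      \<open>r\<close> lie in \<open>P\<close>. Then so does the top coefficient of
      \<open>e ^ M * f\<close>, a product of elements outside \<open>P\<close>.\<close>
    have "poly r y \<notin> P"
    proof
      assume rP: "poly r y \<in> P"
      have "poly q y * poly g' y \<in> P"
        using P_diff[OF lhs rP] eq_y by simp
      then have "poly q y \<in> P"
        using P_prime D q g'(1) g'P by blast
      moreover have "Polynomial.degree q < Polynomial.degree f"
        using deg_q False less.prems(3) g'(3) by linarith
      ultimately have qP: "poly.coeff q i \<in> P" for i
        using minimal q by blast
      have rP': "poly.coeff r i \<in> P" for i
        using minimal[OF r rP] deg_r g'(3) less.prems(3) by simp
      have "poly.coeff (q * g') i \<in> P" for i
        unfolding coeff_mult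
      proof (rule P_sum)
        fix k
        have "poly.coeff g' (i - k) \<in> D"
          using g'(1) assms(2) by (auto simp: polys_over_def)
        then show "poly.coeff q k * poly.coeff g' (i - k) \<in> P"
          using P_mult[OF _ qP, of "poly.coeff g' (i - k)" k] by (simp add: mult.commute)
      qed
      then have "poly.coeff (Polynomial.smult (e ^ M) f) (Polynomial.degree f) \<in> P"
        unfolding e_def eq using rP' by (simp add: P_add)
      moreover have "lead_coeff f \<in> D - P" "e ^ M \<in> D - P"
        using f assms(2) not_P_power[OF e] by (auto simp: polys_over_def)
      ultimately show False
        using not_P_mult by auto
    qed
    moreover have "Polynomial.degree r < Polynomial.degree g" "Polynomial.degree r < Polynomial.degree f"
      using deg_r g'(3) less.prems(3) by linarith+
    ultimately obtain b a where b: "b \<in> adjoin A y" and a: "a \<in> A - P" and ba: "b * poly r y \<approx>\<^sub>P a"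
      using less.hyps[OF _ r] by blast
    have bD: "b \<in> D"
      using b A.adjoin_subset[OF D.unital_subring_axioms assms(2,3)] by blast
    \<comment> \<open>As \<open>f(y)\<close> vanishes modulo \<open>P\<close>, the division shows
      that \<open>r(y)\<close> is congruent to \<open>-q(y) * g'(y)\<close>. The multiplier
      \<open>b\<close> found for \<open>r\<close> thus becomes one for \<open>g\<close> after the
      factor \<open>-q(y)\<close>.\<close>
    have "b * - poly q y \<in> adjoin A y"
      by (intro B.mult_mem B.uminus_mem b B q)
    moreover have "(b * - poly q y) * poly g y \<approx>\<^sub>P a"
    proof -
      have "(b * - poly q y) * poly g y \<approx>\<^sub>P (b * - poly q y) * poly g' y"
        by (intro cong_mult_left gg D.mult_mem D.uminus_mem bD D q)
      also have "(b * - poly q y) * poly g' y \<approx>\<^sub>P b * poly r y"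
      proof (rule cong_D)
        show "(b * - poly q y) * poly g' y - b * poly r y = - (b * (e ^ M * poly f y))"
          unfolding eq_y by (simp add: algebra_simps)
        show "- (b * (e ^ M * poly f y)) \<in> P"
          by (intro P_uminus P_mult bD lhs)
      qed
      also note ba
      finally show ?thesis .
    qed
    ultimately show ?thesis
      using a by blast
  qed
qed

text \<open>Some multiple of \<open>b\<close> is congruent to an \<open>a\<close> in
  \<open>A - P\<close>, so if \<open>p\<close> divides a power of \<open>b\<close>, it divides a
  power of \<open>a\<close> in \<open>adjoin A y\<close>. Reduction by \<open>f\<close>, at the cost
  of powers of \<open>d\<close>, brings the cofactor to degree below that of \<open>f\<close>; there
  minimality allows constant coefficients to be compared in \<open>A\<close>.\<close>

lemma persistent_adjoin_algebraic:
  assumes "unital_subring A" "A \<subseteq> D" "y \<in> D" "persistent A"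
    and f: "f \<in> polys_over A" "poly f y \<in> P" "lead_coeff f \<notin> P"
    and minimal: "\<And>g i. \<lbrakk>g \<in> polys_over A; poly g y \<in> P; Polynomial.degree g < Polynomial.degree f\<rbrakk>
                    \<Longrightarrow> poly.coeff g i \<in> P"
  shows "persistent (adjoin A y)"
  unfolding persistent_def
proof (intro ballI)
  interpret A: unital_subring A by fact
  interpret polys: unital_subring "polys_over A" by (rule A.polys_over_subring)
  interpret B: unital_subring "adjoin A y" by (rule A.adjoin_subring)
  have D: "poly h y \<in> D" if "h \<in> polys_over A" for h
    using that assms(2,3) polys_over_mono D.poly_mem by blast
  have BD: "adjoin A y \<subseteq> D"
    by (rule A.adjoin_subset[OF D.unital_subring_axioms assms(2,3)])
  define d where "d = lead_coeff f"
  have d: "d \<in> A - P"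
    using f by (auto simp: d_def polys_over_def)
  have deg: "Polynomial.degree f > 0"
  proof (rule ccontr)
    assume "\<not> ?thesis"
    then obtain a where "f = [:a:]"
      by (auto elim: degree_eq_zeroE)
    then show False
      using f(2,3) by simp
  qed
  have division: "\<exists>M. \<exists>r \<in> polys_over A. Polynomial.degree r < Polynomial.degree f \<and>
      d ^ M * poly h y \<approx>\<^sub>P poly r y" if h: "h \<in> polys_over A" for h
  proof -
    obtain M q r where q: "q \<in> polys_over A" and r: "r \<in> polys_over A"
      and eq: "Polynomial.smult (d ^ M) h = q * f + r"
      and deg_r: "Polynomial.degree r < Polynomial.degree f"
      using A.pseudo_division[OF h f(1) deg] unfolding d_def by auto
    have "d ^ M * poly h y - poly r y = poly q y * poly f y"
      using arg_cong[OF eq, of "\<lambda>h. poly h y"] by simp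
    then have "d ^ M * poly h y \<approx>\<^sub>P poly r y"
      by (rule cong_D) (intro P_mult D q f)
    then show ?thesis
      using r deg_r by blast
  qed
  fix b assume b: "b \<in> adjoin A y - P"
  then obtain g where g: "g \<in> polys_over A" "b = poly g y"
    by (auto simp: adjoin_def)
  obtain M r where r: "r \<in> polys_over A" "Polynomial.degree r < Polynomial.degree f"
    "d ^ M * b \<approx>\<^sub>P poly r y"
    using division[OF g(1)] g(2) by auto
  have "d ^ M * b \<in> D - P"
    using d b assms(2) BD by (intro not_P_mult not_P_power) auto
  then have "poly r y \<notin> P"
    using cong_P[OF r(3)] by simp
  then obtain b' a where b': "b' \<in> adjoin A y" and a: "a \<in> A - P" and "b' * poly r y \<approx>\<^sub>P a"
    using divides_constant[OF assms(1-3) f minimal r(1) _ r(2)] by blast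
  moreover have "b' * (d ^ M * b) \<approx>\<^sub>P b' * poly r y"
    using b' BD by (intro cong_mult_left r) auto
  ultimately have "b' * (d ^ M * b) \<approx>\<^sub>P a"
    using cong_trans by blast
  moreover define b'' where "b'' = b' * d ^ M"
  ultimately have b''a: "b'' * b \<approx>\<^sub>P a"
    by (simp add: mult.assoc)
  have b'': "b'' \<in> adjoin A y"
    unfolding b''_def using d A.subset_adjoin by (intro B.mult_mem b' B.power_mem) auto
  have dD: "d \<in> D - P" and aD: "a \<in> D - P"
    using d a assms(2) by auto
  \<comment> \<open>\<open>N\<close> is taken for \<open>d * a\<close> and not for \<open>a\<close>,
    because reducing the cofactor by \<open>f\<close> introduces a power of
    \<open>d\<close>.\<close>
  have "d * a \<in> A - P"
    using not_P_mult[OF dD aD] d a A.mult_mem by auto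
  then obtain N :: nat where N: "N > 0"
    "\<And>p m c. \<lbrakk>Factorial_Ring.prime p; \<not> p dvd N; c \<in> A\<rbrakk> \<Longrightarrow> \<not> (d * a) ^ m \<approx>\<^sub>P of_nat p * c"
    by (rule persistentE[OF assms(4)]) blast
  show "\<exists>N>0. \<forall>p m. Factorial_Ring.prime p \<longrightarrow> \<not> p dvd N \<longrightarrow>
          (\<forall>c\<in>adjoin A y. \<not> b ^ m \<approx>\<^sub>P of_nat p * c)"
  proof (intro exI[of _ N] conjI allI impI ballI notI N(1))
    fix p m c
    assume p: "Factorial_Ring.prime p" "\<not> p dvd N" and c: "c \<in> adjoin A y" "b ^ m \<approx>\<^sub>P of_nat p * c"
    define c' where "c' = b'' ^ m * c"
    have c': "c' \<in> adjoin A y"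
      unfolding c'_def by (intro B.mult_mem B.power_mem b'' c)
    then obtain h where h: "h \<in> polys_over A" "c' = poly h y"
      by (auto simp: adjoin_def)
    obtain k r where r: "r \<in> polys_over A" "Polynomial.degree r < Polynomial.degree f"
      "d ^ k * c' \<approx>\<^sub>P poly r y"
      using division[OF h(1)] h(2) by auto
    have "a ^ m \<approx>\<^sub>P (b'' * b) ^ m"
      using b'' b BD aD by (intro cong_power cong_sym[OF b''a] D.mult_mem) auto
    also have "(b'' * b) ^ m \<approx>\<^sub>P b'' ^ m * (of_nat p * c)"
      unfolding power_mult_distrib using b'' BD by (intro cong_mult_left c D.power_mem) auto
    finally have "a ^ m \<approx>\<^sub>P of_nat p * c'"
      by (simp add: c'_def algebra_simps)
    then have "d ^ k * a ^ m \<approx>\<^sub>P d ^ k * (of_nat p * c')"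
      using dD by (intro cong_mult_left D.power_mem) auto
    also have "d ^ k * (of_nat p * c') \<approx>\<^sub>P of_nat p * poly r y"
      using cong_mult_left[OF r(3) D.of_nat_mem[of p]] by (simp add: algebra_simps)
    finally have eq: "d ^ k * a ^ m \<approx>\<^sub>P of_nat p * poly r y" .
    \<comment> \<open>\<open>F\<close> vanishes at \<open>y\<close> modulo \<open>P\<close> and has
      smaller degree than \<open>f\<close>, so all its coefficients lie in \<open>P\<close>.\<close>
    define F where "F = [:d ^ k * a ^ m:] - of_nat p * r"
    have "F \<in> polys_over A"
      unfolding F_def using d a r(1)
      by (intro polys.diff_mem polys.mult_mem polys.of_nat_mem A.polys_over_const A.mult_mem A.power_mem) auto
    moreover have "poly F y \<in> P"
      using eq by (simp add: F_def cong_mod_def)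
    moreover have "Polynomial.degree F < Polynomial.degree f"
      unfolding F_def of_nat_poly using r(2) deg by (intro degree_diff_less) (auto intro: le_less_trans degree_smult_le)
    ultimately have "poly.coeff F 0 \<in> P"
      by (rule minimal)
    then have "d ^ k * a ^ m \<approx>\<^sub>P of_nat p * poly.coeff r 0"
      by (simp add: F_def cong_mod_def of_nat_poly)
    \<comment> \<open>The extra factor balances the exponents of \<open>d\<close> and
      \<open>a\<close>, giving a power of \<open>d * a\<close>.\<close>
    then have "(d ^ m * a ^ k) * (d ^ k * a ^ m) \<approx>\<^sub>P (d ^ m * a ^ k) * (of_nat p * poly.coeff r 0)"
      using dD aD by (intro cong_mult_left D.mult_mem D.power_mem) auto
    then have "(d * a) ^ (m + k) \<approx>\<^sub>P of_nat p * (d ^ m * a ^ k * poly.coeff r 0)"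
      by (simp add: power_mult_distrib power_add algebra_simps)
    moreover have "d ^ m * a ^ k * poly.coeff r 0 \<in> A"
      using d a r(1) by (intro A.mult_mem A.power_mem) (auto simp: polys_over_def)
    ultimately show False
      using N(2)[OF p] by blast
  qed
qed

lemma persistent_adjoin:
  assumes "unital_subring A" "A \<subseteq> D" "y \<in> D" "persistent A"
  shows "persistent (adjoin A y)"
proof -
  interpret A: unital_subring A by fact
  \<comment> \<open>\<open>R\<close> collects the nontrivial algebraic relations of \<open>y\<close>
    over \<open>A\<close> modulo \<open>P\<close>.\<close>
  define R where "R f \<longleftrightarrow> f \<in> polys_over A \<and> poly f y \<in> P \<and> (\<exists>i. poly.coeff f i \<notin> P)" for f
  show ?thesis
  proof (cases "\<exists>f. R f")
    case False
    then show ?thesis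
      unfolding R_def by (intro persistent_adjoin_transcendental assms) blast
  next
    case True
    then obtain f0 where f0: "R f0" "\<And>g. R g \<Longrightarrow> Polynomial.degree f0 \<le> Polynomial.degree g"
      using ex_has_least_nat[of R _ Polynomial.degree] by blast
    from f0(1) obtain i where i: "f0 \<in> polys_over A" "poly f0 y \<in> P" "poly.coeff f0 i \<notin> P"
      unfolding R_def by blast
    \<comment> \<open>Truncating \<open>f0\<close> keeps its value modulo \<open>P\<close> and does
      not raise the degree, so minimality carries over to \<open>f\<close>.\<close>
    obtain f where f: "f \<in> polys_over A" "lead_coeff f \<notin> P" "Polynomial.degree f \<le> Polynomial.degree f0"
      "\<And>i. poly.coeff f i \<approx>\<^sub>P poly.coeff f0 i"
      using lead_coeff_not_in_P[OF i(1) A.zero_mem i(3)] by blast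
    show ?thesis
    proof (rule persistent_adjoin_algebraic[OF assms f(1) _ f(2)])
      show "poly f y \<in> P"
        using cong_P[OF poly_cong[OF f(4) assms(3)]] i(2) by blast
      fix g i assume "g \<in> polys_over A" "poly g y \<in> P" "Polynomial.degree g < Polynomial.degree f"
      moreover have "\<not> R g"
        using f0(2)[of g] f(3) calculation(3) by linarith
      ultimately show "poly.coeff g i \<in> P"
        unfolding R_def by blast
    qed
  qed
qed

lemma persistent_finitely_generated:
  assumes "finite Y" "Y \<subseteq> D"
  shows "\<exists>A. unital_subring A \<and> Y \<subseteq> A \<and> A \<subseteq> D \<and> persistent A"
  using assms
proof (induction Y)
  case empty
  have "unital_subring (range of_int :: 'a set)"
    by unfold_locales (auto simp: image_iff intro: exI[of _ 1] simp flip: of_int_diff of_int_mult)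
  then show ?case
    using persistent_ints D.of_int_mem by (intro exI[of _ "range of_int"]) auto
next
  case (insert y Y)
  then obtain A where A: "unital_subring A" "Y \<subseteq> A" "A \<subseteq> D" "persistent A"
    by auto
  then interpret A: unital_subring A by simp
  have "adjoin A y \<subseteq> D"
    using insert.prems by (intro A.adjoin_subset D.unital_subring_axioms A) auto
  moreover have "persistent (adjoin A y)"
    using insert.prems by (intro persistent_adjoin A) auto
  ultimately show ?case
    using A(2) A.adjoin_subring A.subset_adjoin[of y] A.generator_mem_adjoin[of y]
    by (intro exI[of _ "adjoin A y"]) auto
qed

text \<open>The hypothesis on \<open>Z\<close> says that \<open>D\<close> modulo \<open>P\<close> is contained in \<open>A[1/s]\<close>, where \<open>A\<close> is generated
  by the \<open>m g\<close> and \<open>s\<close> is their product. In particular \<open>D\<close> itself need not be finitely generated.\<close>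

lemma finite_primes_dividing:
  fixes m :: "'b \<Rightarrow> 'a"
  assumes "Z \<subseteq> D" and generated: "\<And>K. \<lbrakk>unital_subring K; Z \<subseteq> K\<rbrakk> \<Longrightarrow> D \<subseteq> K"
    and G: "finite G" "m ` G \<subseteq> D - P"
    and monomial: "\<And>x. x \<in> Z - P \<Longrightarrow> \<exists>N e. x * (\<Prod>g\<in>G. m g) ^ N = (\<Prod>g\<in>G. m g ^ (e g :: nat))"
    and "k \<noteq> 0"
  shows "finite {p. Factorial_Ring.prime p \<and> (\<exists>x\<in>D. of_nat p * x \<approx>\<^sub>P of_int k)}"
proof -
  define s where "s = (\<Prod>g\<in>G. m g)"
  obtain A where A: "unital_subring A" "m ` G \<subseteq> A" "A \<subseteq> D" "persistent A"
    using persistent_finitely_generated[of "m ` G"] G by auto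
  interpret A: unital_subring A by fact
  have sP: "s \<in> D - P"
    unfolding s_def by (rule not_P_prod) (use G in auto)
  have sA: "s \<in> A"
    unfolding s_def by (rule A.prod_mem) (use A in auto)
  \<comment> \<open>Modulo \<open>P\<close> these are the elements of \<open>D\<close> lying in
    \<open>A[1/s]\<close>. They form a ring containing \<open>Z\<close>, hence are all of
    \<open>D\<close>.\<close>
  define K where "K = {x \<in> D. \<exists>N. \<exists>c\<in>A. s ^ N * x \<approx>\<^sub>P c}"
  have "unital_subring K"
  proof
    have "s ^ 0 * 1 \<approx>\<^sub>P 1" by (simp add: cong_refl)
    then show "1 \<in> K"
      unfolding K_def using D.one_mem A.one_mem by blast
  next
    fix x y assume "x \<in> K" "y \<in> K"
    then obtain M c N d where x: "x \<in> D" "c \<in> A" "s ^ M * x \<approx>\<^sub>P c"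
      and y: "y \<in> D" "d \<in> A" "s ^ N * y \<approx>\<^sub>P d"
      unfolding K_def by blast
    have sD: "s ^ i \<in> D" "s ^ i \<in> A" for i
      using sP sA D.power_mem A.power_mem by auto
    have "s ^ N * (s ^ M * x) - s ^ M * (s ^ N * y) \<approx>\<^sub>P s ^ N * c - s ^ M * d"
      by (intro cong_diff cong_mult_left x y sD)
    then have "s ^ (M + N) * (x - y) \<approx>\<^sub>P s ^ N * c - s ^ M * d"
      by (simp add: power_add algebra_simps)
    moreover have "s ^ N * c - s ^ M * d \<in> A"
      by (intro A.diff_mem A.mult_mem sD x y)
    ultimately show "x - y \<in> K"
      unfolding K_def using D.diff_mem[OF x(1) y(1)] by blast
    have "(s ^ M * x) * (s ^ N * y) \<approx>\<^sub>P c * d"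
      using x y A(3) by (intro cong_mult D.mult_mem sD) auto
    then have "s ^ (M + N) * (x * y) \<approx>\<^sub>P c * d"
      by (simp add: power_add algebra_simps)
    then show "x * y \<in> K"
      unfolding K_def using D.mult_mem[OF x(1) y(1)] A.mult_mem[OF x(2) y(2)] by blast
  qed
  moreover have "Z \<subseteq> K"
  proof
    fix x assume x: "x \<in> Z"
    show "x \<in> K"
    proof (cases "x \<in> P")
      case True
      then have "s ^ 0 * x \<approx>\<^sub>P 0" by (simp add: cong_0)
      then show ?thesis
        unfolding K_def using x assms(1) A.zero_mem by blast
    next
      case False
      then obtain N e where "x * s ^ N = (\<Prod>g\<in>G. m g ^ (e g :: nat))"
        using monomial x unfolding s_def by blast
      then have "s ^ N * x \<approx>\<^sub>P (\<Prod>g\<in>G. m g ^ e g)"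
        by (simp add: cong_refl mult.commute)
      moreover have "(\<Prod>g\<in>G. m g ^ e g) \<in> A"
        using A(2) by (intro A.prod_mem A.power_mem) auto
      ultimately show ?thesis
        unfolding K_def using x assms(1) by blast
    qed
  qed
  ultimately have DK: "D \<subseteq> K"
    by (rule generated)
  have kP: "of_int k \<in> D - P"
    using P_of_int assms(6) D.of_int_mem by blast
  have "of_int k * s \<in> A - P"
    using not_P_mult[OF kP sP] A.of_int_mem A.mult_mem sA by blast
  then obtain N :: nat where N: "N > 0"
    "\<And>p j c. \<lbrakk>Factorial_Ring.prime p; \<not> p dvd N; c \<in> A\<rbrakk> \<Longrightarrow> \<not> (of_int k * s) ^ j \<approx>\<^sub>P of_nat p * c"
    by (rule persistentE[OF A(4)]) blast
  have "{p. Factorial_Ring.prime p \<and> (\<exists>x\<in>D. of_nat p * x \<approx>\<^sub>P of_int k)} \<subseteq> {p. p dvd N}"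
  proof clarify
    fix p x assume p: "Factorial_Ring.prime p" and x: "x \<in> D" "of_nat p * x \<approx>\<^sub>P of_int k"
    show "p dvd N"
    proof (rule ccontr)
      assume N': "\<not> p dvd N"
      obtain M c where c: "c \<in> A" "s ^ M * x \<approx>\<^sub>P c"
        using DK x(1) unfolding K_def by blast
      \<comment> \<open>\<open>t\<close> completes \<open>s ^ M * of_int k\<close> to a power of
        \<open>of_int k * s\<close>. Replacing \<open>of_int k\<close> by
        \<open>of_nat p * x\<close> then shows that \<open>p\<close> divides this power, with
        cofactor in \<open>A\<close>.\<close>
      define t where "t = of_int k ^ M * s"
      have t: "t \<in> A"
        unfolding t_def by (intro A.mult_mem A.power_mem A.of_int_mem sA)
      have tD: "t * s ^ M \<in> D" "of_nat p * t \<in> D"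
        using t A(3) sP by (auto intro!: D.mult_mem D.power_mem D.of_nat_mem)
      have "(t * s ^ M) * of_int k \<approx>\<^sub>P (t * s ^ M) * (of_nat p * x)"
        by (intro cong_mult_left cong_sym[OF x(2)] tD)
      also have "(t * s ^ M) * (of_nat p * x) = (of_nat p * t) * (s ^ M * x)"
        by (simp add: algebra_simps)
      also have "(of_nat p * t) * (s ^ M * x) \<approx>\<^sub>P (of_nat p * t) * c"
        by (intro cong_mult_left c tD)
      finally have "(of_int k * s) ^ Suc M \<approx>\<^sub>P of_nat p * (t * c)"
        by (simp add: t_def power_mult_distrib algebra_simps)
      then show False
        using N(2)[OF p N'] A.mult_mem[OF t c(1)] by blast
    qed
  qed
  then show ?thesis
    by (rule finite_subset) (rule finite_divisors_nat[OF N(1)])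
qed

end

section \<open>Prime ideals avoiding a multiplicatively closed set\<close>

definition ideal_in :: "'a::comm_ring_1 set \<Rightarrow> 'a set \<Rightarrow> bool" where
  "ideal_in D Q \<longleftrightarrow> Q \<subseteq> D \<and> 0 \<in> Q \<and> (\<forall>x\<in>Q. \<forall>y\<in>Q. x - y \<in> Q) \<and> (\<forall>x\<in>D. \<forall>y\<in>Q. x * y \<in> Q)"

lemma (in unital_subring) prime_avoiding_exists:
  assumes J: "ideal_in A J"
    and W: "W \<subseteq> A" "\<And>x y. \<lbrakk>x \<in> W; y \<in> W\<rbrakk> \<Longrightarrow> x * y \<in> W" "J \<inter> W = {}"
  shows "\<exists>Q. ideal_in A Q \<and> J \<subseteq> Q \<and> Q \<inter> W = {} \<and>
           (\<forall>x\<in>A. \<forall>y\<in>A. x * y \<in> Q \<longrightarrow> x \<in> Q \<or> y \<in> Q)"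
proof -
  define \<A> where "\<A> = {Q. ideal_in A Q \<and> J \<subseteq> Q \<and> Q \<inter> W = {}}"
  have "\<exists>Q\<in>\<A>. \<forall>Q'\<in>\<A>. Q \<subseteq> Q' \<longrightarrow> Q' = Q"
  proof (rule subset_Zorn_nonempty)
    show "\<A> \<noteq> {}"
      using J W unfolding \<A>_def by blast
  next
    fix \<C> assume ne: "\<C> \<noteq> {}" and chain: "subset.chain \<A> \<C>"
    have mem: "ideal_in A Q" "J \<subseteq> Q" "Q \<inter> W = {}" if "Q \<in> \<C>" for Q
      using chain that unfolding subset.chain_def \<A>_def by blast+
    have join: "\<exists>Q\<in>\<C>. x \<in> Q \<and> y \<in> Q" if "x \<in> \<Union>\<C>" "y \<in> \<Union>\<C>" for x y
      using chain that unfolding subset.chain_def by blast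
    have "ideal_in A (\<Union>\<C>)"
      unfolding ideal_in_def
    proof (intro conjI ballI)
      show "\<Union>\<C> \<subseteq> A" "0 \<in> \<Union>\<C>"
        using mem(1) ne unfolding ideal_in_def by blast+
      show "x - y \<in> \<Union>\<C>" if "x \<in> \<Union>\<C>" "y \<in> \<Union>\<C>" for x y
        using join[OF that] mem(1) unfolding ideal_in_def by blast
      show "x * y \<in> \<Union>\<C>" if "x \<in> A" "y \<in> \<Union>\<C>" for x y
        using that mem(1) unfolding ideal_in_def by blast
    qed
    then show "\<Union>\<C> \<in> \<A>"
      using mem ne unfolding \<A>_def by blast
  qed
  then obtain Q where Q\<A>: "Q \<in> \<A>" and max\<A>: "\<forall>Q'\<in>\<A>. Q \<subseteq> Q' \<longrightarrow> Q' = Q"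
    by (elim bexE)
  from Q\<A> have Q: "ideal_in A Q" "J \<subseteq> Q" "Q \<inter> W = {}"
    by (simp_all add: \<A>_def)
  have max: "Q' = Q" if "ideal_in A Q'" "J \<subseteq> Q'" "Q' \<inter> W = {}" "Q \<subseteq> Q'" for Q'
    using max\<A> that by (simp add: \<A>_def)
  have QA: "Q \<subseteq> A" and Q0: "0 \<in> Q" and Q_diff: "\<And>x y. \<lbrakk>x \<in> Q; y \<in> Q\<rbrakk> \<Longrightarrow> x - y \<in> Q"
    and Q_mult: "\<And>x y. \<lbrakk>x \<in> A; y \<in> Q\<rbrakk> \<Longrightarrow> x * y \<in> Q"
    using Q(1) unfolding ideal_in_def by blast+
  have Q_add: "x + y \<in> Q" if "x \<in> Q" "y \<in> Q" for x y
    using Q_diff[OF that(1) Q_diff[OF Q0 that(2)]] by simp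
  have meets: "\<exists>q\<in>Q. \<exists>d\<in>A. q + d * x \<in> W" if x: "x \<in> A" "x \<notin> Q" for x
  proof (rule ccontr)
    assume contra: "\<not> ?thesis"
    \<comment> \<open>This is the ideal generated by \<open>Q\<close> and \<open>x\<close>; if it
      avoided \<open>W\<close>, it would contradict maximality.\<close>
    define Q' where "Q' = {q + d * x | q d. q \<in> Q \<and> d \<in> A}"
    have "ideal_in A Q'"
      unfolding ideal_in_def
    proof (intro conjI ballI)
      show "Q' \<subseteq> A"
        unfolding Q'_def using QA x add_mem mult_mem by blast
      have "0 = 0 + 0 * x" by simp
      then show "0 \<in> Q'"
        unfolding Q'_def using Q0 zero_mem by blast
    next
      fix u v assume "u \<in> Q'" "v \<in> Q'"
      then obtain q d q' d' where "u = q + d * x" "v = q' + d' * x" "q \<in> Q" "q' \<in> Q" "d \<in> A" "d' \<in> A"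
        unfolding Q'_def by blast
      moreover from this have "u - v = (q - q') + (d - d') * x"
        by (simp add: algebra_simps)
      ultimately show "u - v \<in> Q'"
        unfolding Q'_def using Q_diff diff_mem by blast
    next
      fix u v assume "u \<in> A" "v \<in> Q'"
      then obtain q d where "v = q + d * x" "q \<in> Q" "d \<in> A"
        unfolding Q'_def by blast
      moreover from this have "u * v = u * q + (u * d) * x"
        by (simp add: algebra_simps)
      ultimately show "u * v \<in> Q'"
        unfolding Q'_def using Q_mult mult_mem \<open>u \<in> A\<close> by blast
    qed
    moreover have sub: "Q \<subseteq> Q'"
    proof
      fix q assume "q \<in> Q"
      moreover have "q = q + 0 * x" by simp
      ultimately show "q \<in> Q'"
        unfolding Q'_def using zero_mem by blast
    qed
    moreover have "Q' \<inter> W = {}"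
      using contra unfolding Q'_def by blast
    ultimately have "Q' = Q"
      using max Q(2) by blast
    moreover have "x = 0 + 1 * x" by simp
    then have "x \<in> Q'"
      unfolding Q'_def using Q0 one_mem by blast
    ultimately show False
      using x by blast
  qed
  have "x \<in> Q \<or> y \<in> Q" if xy: "x \<in> A" "y \<in> A" "x * y \<in> Q" for x y
  proof (rule ccontr)
    assume "\<not> ?thesis"
    then obtain q d q' d' where q: "q \<in> Q" "d \<in> A" "q + d * x \<in> W"
      and q': "q' \<in> Q" "d' \<in> A" "q' + d' * y \<in> W"
      using meets xy by metis
    \<comment> \<open>These three terms add up to the product of the two elements of
      \<open>W\<close>.\<close>
    have "(q' + d' * y) * q \<in> Q" "(d * x) * q' \<in> Q" "(d * d') * (x * y) \<in> Q"
      using q q' xy W(1) by (auto intro!: Q_mult mult_mem)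
    then have "(q' + d' * y) * q + ((d * x) * q' + (d * d') * (x * y)) \<in> Q"
      by (intro Q_add)
    also have "(q' + d' * y) * q + ((d * x) * q' + (d * d') * (x * y)) = (q + d * x) * (q' + d' * y)"
      by (simp add: algebra_simps)
    finally show False
      using W(2)[OF q(3) q'(3)] Q(3) by blast
  qed
  then show ?thesis
    using Q by blast
qed

section \<open>Exponent lattices\<close>

text \<open>Submodules over the integers are the same as subgroups. Functions on all of
  \<open>nat\<close> stand in for \<open>n\<close>-tuples; below, only coordinates less than
  \<open>n\<close> are compared.\<close>

interpretation int_fun: Modules.module "\<lambda>(c::int) (f::nat \<Rightarrow> int) i. c * f i"
  by unfold_locales (auto simp: fun_eq_iff algebra_simps)

text \<open>Induction on the number of coordinates: the last coordinates of elements of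
  \<open>H\<close> form an ideal of the integers. An element attaining its least positive value is
  added to generators for the part where the last coordinate is 0.\<close>

lemma finite_span_of_subspace:
  assumes "int_fun.subspace H"
  shows "\<exists>G \<subseteq> H. finite G \<and> (\<forall>h\<in>H. \<exists>u \<in> int_fun.span G. \<forall>i<n. h i = u i)"
  using assms
proof (induction n arbitrary: H)
  case 0
  then show ?case
    by (intro exI[of _ "{}"]) auto
next
  case (Suc n)
  note H_diff = int_fun.subspace_diff[OF Suc.prems]
  note H_scale = int_fun.subspace_scale[OF Suc.prems]
  define H' where "H' = {h \<in> H. h n = 0}"
  have H': "int_fun.subspace H'"
    using Suc.prems by (auto simp: int_fun.subspace_def H'_def)
  obtain G where G: "G \<subseteq> H'" "finite G"
    and span: "\<forall>h\<in>H'. \<exists>u \<in> int_fun.span G. \<forall>i<n. h i = u i"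
    using Suc.IH[OF H'] by (elim exE conjE)
  have "int_fun.span G \<subseteq> H'"
    by (rule int_fun.span_minimal[OF G(1) H'])
  \<comment> \<open>Coordinate \<open>n\<close> agrees as well, since both sides vanish
    there.\<close>
  then have span': "\<exists>u \<in> int_fun.span G. \<forall>i<Suc n. h i = u i" if "h \<in> H'" for h
    using bspec[OF span that] that by (fastforce simp: H'_def less_Suc_eq)
  show ?case
  proof (cases "H' = H")
    case True
    then show ?thesis
      using G span' by blast
  next
    case False
    define Q where "Q d \<longleftrightarrow> d > 0 \<and> (\<exists>h\<in>H. h n = int d)" for d
    from False obtain h where h: "h \<in> H" "h n \<noteq> 0"
      by (auto simp: H'_def)
    define h' where "h' = (\<lambda>i. sgn (h n) * h i)"
    have "h' \<in> H"
      unfolding h'_def by (rule H_scale) fact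
    moreover have "h' n = int (nat \<bar>h n\<bar>)"
      by (simp add: h'_def sgn_if)
    ultimately have "Q (nat \<bar>h n\<bar>)"
      using h(2) by (auto simp: Q_def)
    then have "Q (Least Q)"
      by (rule LeastI)
    then obtain h0 where h0: "h0 \<in> H" "h0 n = int (Least Q)" and pos: "Least Q > 0"
      by (auto simp: Q_def)
    have "\<exists>u \<in> int_fun.span (insert h0 G). \<forall>i<Suc n. h i = u i" if h: "h \<in> H" for h
    proof -
      \<comment> \<open>Subtracting this multiple of \<open>h0\<close> leaves in coordinate
        \<open>n\<close> a remainder below \<open>Least Q\<close>, which must be 0.\<close>
      define q where "q = h n div h0 n"
      define h1 where "h1 = h - (\<lambda>i. q * h0 i)"
      have h1: "h1 \<in> H"
        unfolding h1_def by (intro H_diff H_scale h h0)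
      have val: "h1 n = h n mod h0 n"
        by (simp add: h1_def q_def minus_div_mult_eq_mod)
      have "h1 n = 0"
      proof (rule ccontr)
        assume "h1 n \<noteq> 0"
        moreover have "0 \<le> h1 n" "h1 n < h0 n"
          using pos by (simp_all add: val h0(2))
        ultimately have "Q (nat (h1 n))" "nat (h1 n) < Least Q"
          using h1 h0(2) by (auto simp: Q_def)
        then show False
          using not_less_Least by blast
      qed
      then obtain u where u: "u \<in> int_fun.span G" "\<forall>i<Suc n. h1 i = u i"
        using span'[of h1] h1 by (auto simp: H'_def)
      have "u \<in> int_fun.span (insert h0 G)"
        using u(1) int_fun.span_mono[of G "insert h0 G"] by blast
      moreover have "h0 \<in> int_fun.span (insert h0 G)"
        by (rule int_fun.span_base) simp
      ultimately have "u + (\<lambda>i. q * h0 i) \<in> int_fun.span (insert h0 G)"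
        by (intro int_fun.span_add int_fun.span_scale)
      moreover have "h i = (u + (\<lambda>i. q * h0 i)) i" if "i < Suc n" for i
        using u(2) that by (auto simp: h1_def)
      ultimately show ?thesis
        by blast
    qed
    moreover have "insert h0 G \<subseteq> H"
      using G(1) h0(1) by (auto simp: H'_def)
    ultimately show ?thesis
      using G(2) by (intro exI[of _ "insert h0 G"]) auto
  qed
qed

text \<open>The generators must come from \<open>F\<close> itself, because in the application only
  elements of \<open>F\<close> are exponents of monomials outside \<open>P\<close>. Each of the
  finitely many generators of the span involves only finitely many elements of
  \<open>F\<close>.\<close>

lemma finite_subset_spanning:
  fixes F :: "(nat \<Rightarrow> int) set"
  shows "\<exists>G \<subseteq> F. finite G \<and> (\<forall>f\<in>F. \<exists>u \<in> int_fun.span G. \<forall>i<n. f i = u i)"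
proof -
  obtain G0 where G0: "G0 \<subseteq> int_fun.span F" "finite G0"
    and span: "\<forall>h \<in> int_fun.span F. \<exists>u \<in> int_fun.span G0. \<forall>i<n. h i = u i"
    using finite_span_of_subspace[OF int_fun.subspace_span, of F n] by (elim exE conjE)
  have "\<exists>T. finite T \<and> T \<subseteq> F \<and> g \<in> int_fun.span T" if "g \<in> G0" for g
  proof -
    have "g \<in> int_fun.span F"
      using that G0(1) by blast
    then obtain T r where T: "finite T" "T \<subseteq> F" and g: "g = (\<Sum>a\<in>T. (\<lambda>i. r a * a i))"
      unfolding int_fun.span_explicit mem_Collect_eq by (elim exE conjE)
    have "g \<in> int_fun.span T"
      unfolding g by (intro int_fun.span_sum int_fun.span_scale) (rule int_fun.span_base)
    then show ?thesis
      using T by blast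
  qed
  then obtain T where T: "\<And>g. g \<in> G0 \<Longrightarrow> finite (T g) \<and> T g \<subseteq> F \<and> g \<in> int_fun.span (T g)"
    by metis
  define G where "G = (\<Union>g\<in>G0. T g)"
  have "G0 \<subseteq> int_fun.span G"
    using T int_fun.span_mono[of "T _" G] by (fastforce simp: G_def)
  then have "int_fun.span G0 \<subseteq> int_fun.span G"
    by (intro int_fun.span_minimal int_fun.subspace_span)
  then show ?thesis
    using T G0(2) span int_fun.span_base[of _ F] by (intro exI[of _ G]) (auto simp: G_def, blast+)
qed

lemma sum_apply:
  fixes f :: "'a \<Rightarrow> 'b \<Rightarrow> 'c::comm_monoid_add"
  shows "(\<Sum>j\<in>J. f j) i = (\<Sum>j\<in>J. f j i)"
  by (induction J rule: infinite_finite_induct) auto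

lemma finite_exponents_spanning:
  fixes F :: "(nat \<Rightarrow>\<^sub>0 nat) set"
  shows "\<exists>G \<subseteq> F. finite G \<and> (\<forall>\<alpha>\<in>F. \<exists>z. \<forall>i<n.
           int (Poly_Mapping.lookup \<alpha> i) = (\<Sum>g\<in>G. z g * int (Poly_Mapping.lookup g i)))"
proof -
  define v where "v \<alpha> i = int (Poly_Mapping.lookup \<alpha> i)" for \<alpha> :: "nat \<Rightarrow>\<^sub>0 nat" and i
  have "inj v"
    by (rule injI) (auto simp: v_def fun_eq_iff intro: poly_mapping_eqI)
  then have inj: "inj_on v G" for G
    by (rule inj_on_subset) simp
  obtain H where H: "H \<subseteq> v ` F" "finite H"
    and span: "\<forall>f \<in> v ` F. \<exists>u \<in> int_fun.span H. \<forall>i<n. f i = u i"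
    using finite_subset_spanning[of "v ` F" n] by (elim exE conjE)
  then obtain G where G: "G \<subseteq> F" "finite G" "H = v ` G"
    by (meson finite_subset_image)
  have "\<exists>z. \<forall>i<n. v \<alpha> i = (\<Sum>g\<in>G. z g * v g i)" if \<alpha>: "\<alpha> \<in> F" for \<alpha>
  proof -
    obtain u where u: "u \<in> int_fun.span H" "\<forall>i<n. v \<alpha> i = u i"
      using bspec[OF span imageI[OF \<alpha>]] by (elim bexE)
    then obtain z where z: "u = (\<Sum>h\<in>H. (\<lambda>i. z h * h i))"
      unfolding int_fun.span_finite[OF H(2)] by (elim imageE)
    have "u i = (\<Sum>g\<in>G. z (v g) * v g i)" for i
      unfolding z G(3) by (simp add: sum_apply sum.reindex[OF inj])
    then show ?thesis
      using u(2) by auto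
  qed
  then show ?thesis
    using G unfolding v_def by blast
qed

text \<open>The coefficients \<open>z g\<close> may be negative. Multiplying by the
  \<open>N\<close>-th power of the product shifts each of them by \<open>N\<close>, and the sum of
  their absolute values is large enough to make all exponents nonnegative.\<close>

lemma monomial_of_cancel:
  assumes "finite G"
    and z: "\<And>i. i < n \<Longrightarrow>
      int (Poly_Mapping.lookup \<alpha> i) = (\<Sum>g\<in>G. z g * int (Poly_Mapping.lookup g i))"
  shows "\<exists>N e. monomial_of n \<alpha> * (\<Prod>g\<in>G. monomial_of n g) ^ N = (\<Prod>g\<in>G. monomial_of n g ^ e g)"
proof -
  define N where "N = (\<Sum>g\<in>G. nat \<bar>z g\<bar>)"
  define e where "e g = nat (int N + z g)" for g
  have e: "int (e g) = int N + z g" if "g \<in> G" for g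
  proof -
    have "nat \<bar>z g\<bar> \<le> N"
      unfolding N_def by (rule member_le_sum) (use that assms(1) in auto)
    then show ?thesis
      by (simp add: e_def)
  qed
  have eq: "Poly_Mapping.lookup \<alpha> i + (\<Sum>g\<in>G. Poly_Mapping.lookup g i * N)
      = (\<Sum>g\<in>G. Poly_Mapping.lookup g i * e g)" if "i < n" for i
  proof -
    have "int (Poly_Mapping.lookup \<alpha> i + (\<Sum>g\<in>G. Poly_Mapping.lookup g i * N))
        = int (\<Sum>g\<in>G. Poly_Mapping.lookup g i * e g)"
      by (simp add: z[OF that] e sum.distrib algebra_simps cong: sum.cong)
    then show ?thesis
      by (simp only: of_nat_eq_iff)
  qed
  have prod: "(\<Prod>g\<in>G. monomial_of n g ^ f g)
      = (\<Prod>i<n. mvar i ^ (\<Sum>g\<in>G. Poly_Mapping.lookup g i * f g))" for f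
  proof -
    have "(\<Prod>g\<in>G. monomial_of n g ^ f g) = (\<Prod>g\<in>G. \<Prod>i<n. mvar i ^ (Poly_Mapping.lookup g i * f g))"
      by (simp add: monomial_of_def power_mult flip: prod_power_distrib)
    also have "\<dots> = (\<Prod>i<n. \<Prod>g\<in>G. mvar i ^ (Poly_Mapping.lookup g i * f g))"
      by (rule prod.swap)
    finally show ?thesis
      by (simp add: power_sum)
  qed
  have "monomial_of n \<alpha> * (\<Prod>g\<in>G. monomial_of n g) ^ N
      = (\<Prod>i<n. mvar i ^ Poly_Mapping.lookup \<alpha> i) * (\<Prod>g\<in>G. monomial_of n g ^ N)"
    by (simp add: monomial_of_def prod_power_distrib)
  also have "\<dots> = (\<Prod>i<n. mvar i ^ (Poly_Mapping.lookup \<alpha> i + (\<Sum>g\<in>G. Poly_Mapping.lookup g i * N)))"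
    unfolding prod by (simp add: power_add prod.distrib)
  also have "\<dots> = (\<Prod>g\<in>G. monomial_of n g ^ e g)"
    unfolding prod using eq by (intro prod.cong) auto
  finally show ?thesis by blast
qed

section \<open>Subrings of the rationals\<close>

text \<open>Set-level counterpart of \<open>subrng\<close>, so that arithmetic uses the type class
  operations instead of ring records.\<close>

definition diff_mult_closed :: "'a::ring set \<Rightarrow> bool" where
  "diff_mult_closed K \<longleftrightarrow> 0 \<in> K \<and> (\<forall>x\<in>K. \<forall>y\<in>K. x - y \<in> K \<and> x * y \<in> K)"

lemma
  assumes "diff_mult_closed K"
  shows diff_mult_closed_0: "0 \<in> K"
    and diff_mult_closed_diff: "\<lbrakk>x \<in> K; y \<in> K\<rbrakk> \<Longrightarrow> x - y \<in> K"
    and diff_mult_closed_mult: "\<lbrakk>x \<in> K; y \<in> K\<rbrakk> \<Longrightarrow> x * y \<in> K"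
    and diff_mult_closed_uminus: "x \<in> K \<Longrightarrow> - x \<in> K"
    and diff_mult_closed_add: "\<lbrakk>x \<in> K; y \<in> K\<rbrakk> \<Longrightarrow> x + y \<in> K"
proof -
  show z: "0 \<in> K" and d: "\<lbrakk>x \<in> K; y \<in> K\<rbrakk> \<Longrightarrow> x - y \<in> K"
    and "\<lbrakk>x \<in> K; y \<in> K\<rbrakk> \<Longrightarrow> x * y \<in> K" for x y
    using assms by (auto simp: diff_mult_closed_def)
  show m: "- x \<in> K" if "x \<in> K" for x
    using d[OF z that] by simp
  show "\<lbrakk>x \<in> K; y \<in> K\<rbrakk> \<Longrightarrow> x + y \<in> K"
    using d[OF _ m] by fastforce
qed

lemma diff_mult_closed_of_int_mult:
  fixes x :: "'a::ring_1"
  assumes "diff_mult_closed K" "x \<in> K"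
  shows "of_int z * x \<in> K"
proof -
  have nat: "of_nat n * x \<in> K" for n
    by (induction n) (auto simp: algebra_simps
        intro: diff_mult_closed_0[OF assms(1)] diff_mult_closed_add[OF assms(1)] assms(2))
  show ?thesis
  proof (cases "z \<ge> 0")
    case True
    then show ?thesis
      using nat[of "nat z"] by simp
  next
    case False
    then show ?thesis
      using diff_mult_closed_uminus[OF assms(1) nat[of "nat (- z)"]] by simp
  qed
qed

lemma ex_power_dvd:
  fixes b d :: nat
  assumes "d > 0" "\<And>p. \<lbrakk>Factorial_Ring.prime p; p dvd d\<rbrakk> \<Longrightarrow> p dvd b"
  shows "\<exists>m. d dvd b ^ m"
  using assms
proof (induction d rule: less_induct)
  case (less d)
  show ?case
  proof (cases "d = 1")
    case True
    then show ?thesis by simp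
  next
    case False
    then obtain p where p: "Factorial_Ring.prime p" "p dvd d"
      using prime_factor_nat by blast
    then obtain e where e: "d = p * e" by (elim dvdE)
    have "e > 0" "e < d"
      using less.prems(1) prime_gt_1_nat[OF p(1)] by (auto simp: e)
    then obtain m where "e dvd b ^ m"
      using less.IH[of e] less.prems(2) e by auto
    then have "d dvd b ^ Suc m"
      using less.prems(2)[OF p] by (simp add: e mult_dvd_mono)
    then show ?thesis by blast
  qed
qed

text \<open>If \<open>k\<close> is the least positive integer in \<open>S\<close> and only finitely many primes divide the
  denominators of elements of \<open>S\<close>, with product \<open>b\<close>, then \<open>S = k\<int>[1/b]\<close>. Here \<open>b\<close> and \<open>k\<close> are coprime,
  and if \<open>1 = ub + vk\<close>, then \<open>k/b\<^sup>m\<^sup>+\<^sup>1 = u(k/b\<^sup>m) + v(k/b\<^sup>m)(k/b)\<close>.\<close>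

lemma rat_subring_generators:
  fixes S :: "rat set"
  assumes S: "diff_mult_closed S"
    and fin: "\<And>k :: nat. \<lbrakk>k > 0; of_nat k \<in> S\<rbrakk> \<Longrightarrow>
                finite {p. Factorial_Ring.prime p \<and> of_nat k / of_nat p \<in> S}"
  shows "\<exists>F \<subseteq> S. finite F \<and> (\<forall>K. diff_mult_closed K \<and> F \<subseteq> K \<longrightarrow> S \<subseteq> K)"
proof (cases "S \<subseteq> {0}")
  case True
  then show ?thesis
    using diff_mult_closed_0 by (intro exI[of _ "{}"]) blast
next
  case False
  define Q where "Q k \<longleftrightarrow> k > 0 \<and> of_nat k \<in> S" for k :: nat
  define k where "k = Least Q"
  note S_mult = diff_mult_closed_mult[OF S]
  note S_int = diff_mult_closed_of_int_mult[OF S]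
  obtain x where x: "x \<in> S" "x \<noteq> 0"
    using False by blast
  have "Q k"
  proof -
    obtain a c where ac: "quotient_of x = (a, c)"
      by (cases "quotient_of x")
    have c: "c > 0" and xac: "x = of_int a / of_int c"
      using quotient_of_denom_pos[OF ac] quotient_of_div[OF ac] by auto
    \<comment> \<open>Clearing the denominator and the sign produces a positive integer in
      \<open>S\<close>.\<close>
    have "of_int (sgn a * c) * x = of_int \<bar>a\<bar>"
      using c by (simp add: xac abs_sgn mult.commute)
    then have "of_int \<bar>a\<bar> \<in> S"
      using S_int[OF x(1), of "sgn a * c"] by simp
    then have "of_nat (nat \<bar>a\<bar>) \<in> S"
      by simp
    moreover have "a \<noteq> 0"
      using x(2) xac by auto
    ultimately have "Q (nat \<bar>a\<bar>)"
      by (simp add: Q_def)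
    then show ?thesis
      unfolding k_def by (rule LeastI)
  qed
  then have k: "k > 0" "of_nat k \<in> S"
    by (simp_all add: Q_def)
  have k_least: "k \<le> j" if "j > 0" "of_nat j \<in> S" for j
    unfolding k_def by (rule Least_le) (use that in \<open>simp add: Q_def\<close>)
  have k_dvd: "int k dvd c" if "of_int c \<in> S" for c
  proof (rule ccontr)
    assume "\<not> int k dvd c"
    then have "c mod int k \<noteq> 0"
      by (simp add: dvd_eq_mod_eq_0)
    then have pos: "c mod int k > 0"
      using k(1) pos_mod_sign[of "int k" c] by linarith
    have "(of_int (c mod int k) :: rat) = of_int c - of_int (c div int k) * of_nat k"
      by (simp add: minus_div_mult_eq_mod[symmetric])
    also have "\<dots> \<in> S"
      by (intro diff_mult_closed_diff[OF S] S_int k that)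
    finally have "k \<le> nat (c mod int k)"
      using pos by (intro k_least) auto
    moreover have "c mod int k < int k"
      using k(1) by simp
    ultimately show False
      using pos by linarith
  qed
  \<comment> \<open>Coprimality to \<open>k\<close> keeps \<open>k / d\<close> in lowest terms,
    which makes these denominators closed under products.\<close>
  define \<D> where "\<D> = {d. d > 0 \<and> coprime k d \<and> of_nat k / of_nat d \<in> S}"
  have \<D>I: "d \<in> \<D>" if d: "d > 0" "coprime c (int d)" "of_int c / of_nat d \<in> S" for c d
  proof -
    \<comment> \<open>Bezout replaces the numerator \<open>c\<close> by \<open>k\<close>, using that
      \<open>k\<close> itself lies in \<open>S\<close>.\<close>
    obtain u v where uv: "u * c + v * int d = 1"
      using bezout_int[of c "int d"] d(2) by (auto simp: coprime_iff_gcd_eq_1)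
    have "(of_nat k :: rat) = of_nat k * of_int (u * c + v * int d)"
      by (simp add: uv)
    then have "(of_nat k :: rat) / of_nat d = of_int (int k * u) * (of_int c / of_nat d) + of_int v * of_nat k"
      using d(1) by (simp add: field_simps)
    also have "\<dots> \<in> S"
      by (intro diff_mult_closed_add[OF S] S_int d k)
    finally have kd: "of_nat k / of_nat d \<in> S" .
    \<comment> \<open>The integer \<open>k' = k / g\<close> is a multiple of \<open>k / d\<close>,
      hence in \<open>S\<close>; minimality of \<open>k\<close> forces \<open>g = 1\<close>.\<close>
    define g where "g = gcd k d"
    obtain k' d' where k': "k = g * k'" and d': "d = g * d'"
      unfolding g_def by (meson dvdE gcd_dvd1 gcd_dvd2)
    have g: "g > 0"
      using k(1) by (simp add: g_def)
    have "(of_nat k' :: rat) = of_int (int d') * (of_nat k / of_nat d)"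
      using d(1) g by (simp add: k' d')
    also have "\<dots> \<in> S"
      by (intro S_int kd)
    finally have "k \<le> k'"
      using k(1) k' by (intro k_least) auto
    then have "g = 1"
      using k' k(1) g by (cases g) auto
    then show ?thesis
      using d(1) kd by (simp add: \<D>_def g_def coprime_iff_gcd_eq_1)
  qed
  \<comment> \<open>Multiplying \<open>k / d\<close> by \<open>k / d'\<close> gives the numerator
    \<open>k * k\<close>, which is coprime to \<open>d * d'\<close>; \<open>\<D>I\<close> turns it
    back into \<open>k\<close>.\<close>
  have \<D>_mult: "d * d' \<in> \<D>" if "d \<in> \<D>" "d' \<in> \<D>" for d d'
  proof (rule \<D>I[of _ "int (k * k)"])
    show "coprime (int (k * k)) (int (d * d'))"
      using that unfolding coprime_int_iff by (auto simp: \<D>_def)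
    show "of_int (int (k * k)) / of_nat (d * d') \<in> S"
      using S_mult[of "of_nat k / of_nat d" "of_nat k / of_nat d'"] that by (auto simp: \<D>_def)
  qed (use that in \<open>auto simp: \<D>_def\<close>)
  have \<D>_dvd: "e \<in> \<D>" if "d \<in> \<D>" "e dvd d" for d e
  proof -
    from that(2) obtain f where f: "d = e * f" ..
    then have "of_nat k / of_nat e = of_int (int f) * (of_nat k / of_nat d :: rat)"
      using that(1) by (simp add: \<D>_def)
    then have "of_nat k / of_nat e \<in> S"
      using S_int[of "of_nat k / of_nat d" "int f"] that(1) by (simp add: \<D>_def)
    then show ?thesis
      using that(1) f by (auto simp: \<D>_def)
  qed
  define b where "b = \<Prod>{p \<in> \<D>. Factorial_Ring.prime p}"
  have fin\<D>: "finite {p \<in> \<D>. Factorial_Ring.prime p}"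
    by (rule finite_subset[OF _ fin[OF k]]) (auto simp: \<D>_def)
  have one\<D>: "1 \<in> \<D>"
    using k by (simp add: \<D>_def)
  have "\<Prod>T \<in> \<D>" if "finite T" "T \<subseteq> \<D>" for T
    using that by (induction T) (use one\<D> \<D>_mult in auto)
  then have b: "b \<in> \<D>"
    unfolding b_def using fin\<D> by blast
  then have kb: "b > 0" "coprime k b" "of_nat k / of_nat b \<in> S"
    by (auto simp: \<D>_def)
  have b_power: "\<exists>m. d dvd b ^ m" if "d \<in> \<D>" for d
  proof (rule ex_power_dvd)
    show "d > 0"
      using that by (simp add: \<D>_def)
    show "p dvd b" if p: "Factorial_Ring.prime p" "p dvd d" for p
      unfolding b_def by (rule dvd_prodI[OF fin\<D>]) (use p \<D>_dvd[OF \<open>d \<in> \<D>\<close>] in blast)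
  qed
  have "S \<subseteq> K" if K: "diff_mult_closed K" and sub: "{of_nat k, of_nat k / of_nat b} \<subseteq> K" for K
  proof
    obtain u v where uv: "u * int b + v * int k = 1"
      using bezout_int[of "int b" "int k"] kb(2) by (auto simp: coprime_iff_gcd_eq_1 gcd.commute)
    have kbm: "of_nat k / of_nat b ^ m \<in> K" for m
    proof (induction m)
      case 0
      then show ?case using sub by simp
    next
      case (Suc m)
      have "(of_nat k :: rat) / of_nat b ^ Suc m
          = of_nat k * of_int (u * int b + v * int k) / of_nat b ^ Suc m"
        by (simp add: uv)
      also have "\<dots> = of_int u * (of_nat k / of_nat b ^ m)
          + of_int v * ((of_nat k / of_nat b ^ m) * (of_nat k / of_nat b))"
        using kb(1) by (simp add: field_simps)
      also have "\<dots> \<in> K"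
        using sub by (intro diff_mult_closed_add[OF K] diff_mult_closed_of_int_mult[OF K]
            diff_mult_closed_mult[OF K] Suc.IH) auto
      finally show ?case .
    qed
    fix x assume x: "x \<in> S"
    obtain c d0 where cd: "quotient_of x = (c, d0)"
      by (cases "quotient_of x")
    define d where "d = nat d0"
    have d: "d > 0" "coprime c (int d)" "x = of_int c / of_nat d"
      using quotient_of_denom_pos[OF cd] quotient_of_div[OF cd] quotient_of_coprime[OF cd]
      by (auto simp: d_def)
    have "d \<in> \<D>"
      using \<D>I d x by blast
    \<comment> \<open>Enlarging the denominator of \<open>x\<close> to \<open>b ^ m\<close> makes
      the numerator \<open>c * f\<close>. This is an integer in \<open>S\<close>, hence a multiple
      of \<open>k\<close>.\<close>
    then obtain m f where f: "b ^ m = d * f"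
      using b_power by (meson dvdE)
    have "of_int (int (b ^ m)) * x = of_int (c * int f)"
      using d(1) unfolding f d(3) by simp
    then have "of_int (c * int f) \<in> S"
      using S_int[OF x, of "int (b ^ m)"] by simp
    then obtain t where t: "c * int f = int k * t"
      using k_dvd by (meson dvdE)
    have "f > 0"
      using f kb(1) by (metis mult_0_right neq0_conv zero_less_power)
    have "x = of_int (c * int f) / of_nat (d * f)"
      using \<open>f > 0\<close> unfolding d(3) by simp
    also have "\<dots> = of_int t * (of_nat k / of_nat b ^ m)"
      unfolding t f[symmetric] by simp
    also have "\<dots> \<in> K"
      by (intro diff_mult_closed_of_int_mult[OF K] kbm)
    finally show "x \<in> K" .
  qed
  then show ?thesis
    using k kb by (intro exI[of _ "{of_nat k, of_nat k / of_nat b}"]) auto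
qed

section \<open>The monoid ring modulo a prime ideal\<close>

lemma subrng_ring_of_type_algebra_iff:
  fixes U :: "'a::ring_1 set"
  assumes "diff_mult_closed U"
  shows "subrng K (ring_of_type_algebra\<lparr>carrier := U\<rparr>) \<longleftrightarrow> K \<subseteq> U \<and> diff_mult_closed K"
proof -
  let ?R = "ring_of_type_algebra\<lparr>carrier := U\<rparr> :: 'a ring"
  \<comment> \<open>Inverses in the restricted record are described within its carrier
    \<open>U\<close>; they agree with negation because \<open>U\<close> is closed under it.\<close>
  have inv: "inv\<^bsub>add_monoid ?R\<^esub> x = - x" if "x \<in> U" for x
    using diff_mult_closed_uminus[OF assms that]
    unfolding m_inv_def ring_of_type_algebra_def
    by (intro the_equality) (auto simp: eq_neg_iff_add_eq_0 add.commute)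
  show ?thesis
  proof
    assume "subrng K ?R"
    then interpret subrng K ?R .
    have sub: "K \<subseteq> U"
      using a_subset by simp
    have "0 \<in> K"
      using zero_closed by (simp add: ring_of_type_algebra_def)
    moreover have "x * y \<in> K" if "x \<in> K" "y \<in> K" for x y
      using mult_closed[OF that] by (simp add: ring_of_type_algebra_def)
    moreover have "x - y \<in> K" if "x \<in> K" "y \<in> K" for x y
    proof -
      have "- y \<in> K"
        using subgroup.m_inv_closed[OF a_subgroup that(2)] inv[OF subsetD[OF sub that(2)]] by metis
      then show ?thesis
        using a_closed[OF that(1), of "- y"] by (simp add: ring_of_type_algebra_def)
    qed
    ultimately show "K \<subseteq> U \<and> diff_mult_closed K"
      using sub by (simp add: diff_mult_closed_def)
  next
    assume K: "K \<subseteq> U \<and> diff_mult_closed K"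
    note closed = diff_mult_closed_0 diff_mult_closed_add diff_mult_closed_mult diff_mult_closed_uminus
    have "subgroup K (add_monoid ?R)"
    proof (rule subgroup.intro)
      show "inv\<^bsub>add_monoid ?R\<^esub> x \<in> K" if "x \<in> K" for x
        using K that inv closed(4)[of K] by auto
    qed (use K closed in \<open>auto simp: ring_of_type_algebra_def\<close>)
    then show "subrng K ?R"
      using K closed(3)[of K]
      by (intro subrng.intro additive_subgroup.intro subrng_axioms.intro)
        (auto simp: ring_of_type_algebra_def)
  qed
qed

lemma diff_mult_closed_UNIV: "diff_mult_closed UNIV"
  by (simp add: diff_mult_closed_def)

lemma subrng_rat_ring_iff: "subrng S rat_ring \<longleftrightarrow> diff_mult_closed S"
proof -
  have "rat_ring = rat_ring\<lparr>carrier := UNIV\<rparr>"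
    by (simp add: ring_of_type_algebra_def)
  then show ?thesis
    using subrng_ring_of_type_algebra_iff[OF diff_mult_closed_UNIV, of S] by simp
qed

lemma infinitely_many_prime_denominators:
  assumes "diff_mult_closed S" "\<not> finitely_generated_rng (rat_ring\<lparr>carrier := S\<rparr>)"
  shows "\<exists>k::nat. k > 0 \<and> of_nat k \<in> S \<and> infinite {p. Factorial_Ring.prime p \<and> of_nat k / of_nat p \<in> S}"
proof (rule ccontr)
  assume contra: "\<not> ?thesis"
  have fin: "finite {p. Factorial_Ring.prime p \<and> of_nat k / of_nat p \<in> S}"
    if "k > 0" "of_nat k \<in> S" for k :: nat
    using contra that by blast
  obtain F where F: "F \<subseteq> S" "finite F" "\<forall>K. diff_mult_closed K \<and> F \<subseteq> K \<longrightarrow> S \<subseteq> K"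
    using rat_subring_generators[OF assms(1), OF fin] by blast
  have "generate_subrng (rat_ring\<lparr>carrier := S\<rparr>) F = S"
    unfolding generate_subrng_def subrng_ring_of_type_algebra_iff[OF assms(1)]
    using F assms(1) by blast
  then show False
    using assms(2) F(1,2) unfolding finitely_generated_rng_def by auto
qed

section \<open>Monoid rings inside the polynomial ring\<close>

lemma keys_times_subset:
  fixes p q :: "(nat \<Rightarrow>\<^sub>0 nat) \<Rightarrow>\<^sub>0 int"
  assumes "Poly_Mapping.keys p \<subseteq> carrier (exponent_monoid n)"
    "Poly_Mapping.keys q \<subseteq> carrier (exponent_monoid n)"
  shows "Poly_Mapping.keys (p * q) \<subseteq> carrier (exponent_monoid n)"
proof
  fix \<gamma> assume "\<gamma> \<in> Poly_Mapping.keys (p * q)"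
  then obtain \<alpha> \<beta> where "\<gamma> = \<alpha> + \<beta>" "\<alpha> \<in> Poly_Mapping.keys p" "\<beta> \<in> Poly_Mapping.keys q"
    using keys_mult[of p q] by blast
  then show "\<gamma> \<in> carrier (exponent_monoid n)"
    using assms Poly_Mapping.keys_add[of \<alpha> \<beta>] unfolding exponent_monoid_def by fastforce
qed

lemma carrier_int_mpoly_subring: "unital_subring (carrier (int_mpoly_ring n))"
proof
  show "1 \<in> carrier (int_mpoly_ring n)"
    by (simp add: int_mpoly_ring_def exponent_monoid_def)
  fix p q assume "p \<in> carrier (int_mpoly_ring n)" "q \<in> carrier (int_mpoly_ring n)"
  then show "p - q \<in> carrier (int_mpoly_ring n)" "p * q \<in> carrier (int_mpoly_ring n)"
    using keys_times_subset[of p n q] Poly_Mapping.keys_diff[of p q]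
    by (auto simp: int_mpoly_ring_def)
qed

lemma unital_subring_diff_mult_closed: "unital_subring A \<Longrightarrow> diff_mult_closed A"
  unfolding diff_mult_closed_def
  by (simp add: unital_subring.zero_mem unital_subring.diff_mem unital_subring.mult_mem)

lemma subrng_int_mpoly_ring_iff:
  "subrng K (int_mpoly_ring n) \<longleftrightarrow> K \<subseteq> carrier (int_mpoly_ring n) \<and> diff_mult_closed K"
proof -
  have "int_mpoly_ring n = ring_of_type_algebra\<lparr>carrier := carrier (int_mpoly_ring n)\<rparr>"
    by (simp add: int_mpoly_ring_def)
  then show ?thesis
    using subrng_ring_of_type_algebra_iff[OF
        unital_subring_diff_mult_closed[OF carrier_int_mpoly_subring], of K n] by simp
qed

lemma monomial_of_mem: "monomial_of n \<alpha> \<in> carrier (int_mpoly_ring n)"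
proof -
  interpret unital_subring "carrier (int_mpoly_ring n)"
    by (rule carrier_int_mpoly_subring)
  have "mvar i \<in> carrier (int_mpoly_ring n)" if "i < n" for i
    using that by (simp add: mvar_def int_mpoly_ring_def exponent_monoid_def)
  then show ?thesis
    unfolding monomial_of_def by (intro prod_mem power_mem) auto
qed

lemma monomial_of_0: "monomial_of n 0 = 1"
  by (simp add: monomial_of_def)

lemma carrier_int_monoid_ring:
  "carrier (int_monoid_ring n C) = \<Inter> {K. K \<subseteq> carrier (int_mpoly_ring n) \<and> diff_mult_closed K \<and> monomial_of n ` C \<subseteq> K}"
  by (simp add: int_monoid_ring_def generate_subrng_def subrng_int_mpoly_ring_iff conj_assoc)

lemma int_monoid_ring_simps:
  "x \<otimes>\<^bsub>int_monoid_ring n C\<^esub> y = x * y"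
  "x \<oplus>\<^bsub>int_monoid_ring n C\<^esub> y = x + y"
  "\<one>\<^bsub>int_monoid_ring n C\<^esub> = 1"
  "\<zero>\<^bsub>int_monoid_ring n C\<^esub> = 0"
  by (simp_all add: int_monoid_ring_def int_mpoly_ring_def ring_of_type_algebra_def)

text \<open>Although generation is non-unital, the unity is present as the monomial with exponent
  0.\<close>

lemma carrier_int_monoid_subring:
  assumes "0 \<in> C"
  shows "unital_subring (carrier (int_monoid_ring n C))"
  unfolding carrier_int_monoid_ring
proof
  have "1 \<in> monomial_of n ` C"
    using assms monomial_of_0 by (metis imageI)
  then show "1 \<in> \<Inter> {K. K \<subseteq> carrier (int_mpoly_ring n) \<and> diff_mult_closed K \<and> monomial_of n ` C \<subseteq> K}"
    by blast
qed (auto intro: diff_mult_closed_diff diff_mult_closed_mult)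

lemma carrier_int_monoid_ring_least:
  assumes K: "unital_subring K" "monomial_of n ` C \<subseteq> K"
  shows "carrier (int_monoid_ring n C) \<subseteq> K"
proof -
  \<comment> \<open>\<open>K\<close> may contain polynomials in further variables, so it is first
    cut down to the polynomial ring.\<close>
  have "diff_mult_closed (K \<inter> carrier (int_mpoly_ring n))"
    using unital_subring_diff_mult_closed[OF K(1)] unital_subring_diff_mult_closed[OF carrier_int_mpoly_subring]
    by (auto simp: diff_mult_closed_def)
  then show ?thesis
    unfolding carrier_int_monoid_ring using K(2) monomial_of_mem by blast
qed

text \<open>The set \<open>G\<close> is chosen among exponents of monomials outside
  \<open>P\<close>, so the product of these monomials is nonzero modulo \<open>P\<close> and can
  serve as the common denominator \<open>s\<close> for all other surviving monomials.\<close>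

lemma finite_primes_dividing_mod_prime:
  assumes "prime_mod (carrier (int_monoid_ring n C)) P" "k \<noteq> 0"
  shows "finite {p. Factorial_Ring.prime p \<and>
           (\<exists>x \<in> carrier (int_monoid_ring n C). of_nat p * x - of_int k \<in> P)}"
proof -
  interpret prime_mod "carrier (int_monoid_ring n C)" P by fact
  define F where "F = {\<alpha> \<in> C. monomial_of n \<alpha> \<notin> P}"
  have sub: "monomial_of n ` C \<subseteq> carrier (int_monoid_ring n C)"
    unfolding carrier_int_monoid_ring by blast
  obtain G where G: "G \<subseteq> F" "finite G"
    and span: "\<forall>\<alpha>\<in>F. \<exists>z. \<forall>i<n.
      int (Poly_Mapping.lookup \<alpha> i) = (\<Sum>g\<in>G. z g * int (Poly_Mapping.lookup g i))"
    using finite_exponents_spanning[of F n] by (elim exE conjE)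
  show ?thesis
    unfolding cong_mod_def[symmetric]
  proof (rule finite_primes_dividing[OF sub _ G(2) _ _ assms(2)])
    show "monomial_of n ` G \<subseteq> carrier (int_monoid_ring n C) - P"
      using G(1) sub by (auto simp: F_def)
    fix x assume "x \<in> monomial_of n ` C - P"
    then obtain \<alpha> where \<alpha>: "x = monomial_of n \<alpha>" "\<alpha> \<in> F"
      by (auto simp: F_def)
    obtain z where "\<forall>i<n. int (Poly_Mapping.lookup \<alpha> i) = (\<Sum>g\<in>G. z g * int (Poly_Mapping.lookup g i))"
      using bspec[OF span \<alpha>(2)] by (elim exE)
    then show "\<exists>N e. x * (\<Prod>g\<in>G. monomial_of n g) ^ N = (\<Prod>g\<in>G. monomial_of n g ^ e g)"
      unfolding \<alpha>(1) using monomial_of_cancel[OF G(2), of n \<alpha> z] by blast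
  qed (rule carrier_int_monoid_ring_least)
qed

section \<open>The prime ideal attached to a copy of \<open>S\<close> in \<open>R\<close>\<close>

theorem corollary4p8:
  fixes n :: nat
    and C :: "(nat \<Rightarrow>\<^sub>0 nat) set"
    and I :: "((nat \<Rightarrow>\<^sub>0 nat) \<Rightarrow>\<^sub>0 int) set"
    and R :: "('r, 'x) ring_scheme"
    and S :: "rat set"
  assumes "n \<ge> 1"
    and "submonoid C (exponent_monoid n)"
    and "ideal I (int_monoid_ring n C)"
    and "ring R"
    and "int_monoid_ring n C Quot I \<simeq> R"
    and "subrng S rat_ring"
    and "\<not> finitely_generated_rng (rat_ring\<lparr>carrier := S\<rparr>)"
  shows "\<not> (\<exists>T. subrng T R \<and> rng_isomorphic (rat_ring\<lparr>carrier := S\<rparr>) (R\<lparr>carrier := T\<rparr>))"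
proof
  assume "\<exists>T. subrng T R \<and> rng_isomorphic (rat_ring\<lparr>carrier := S\<rparr>) (R\<lparr>carrier := T\<rparr>)"
  then obtain T h where T: "subrng T R"
    and h_add_iso: "h \<in> iso (add_monoid (rat_ring\<lparr>carrier := S\<rparr>)) (add_monoid (R\<lparr>carrier := T\<rparr>))"
    and h_mult_iso: "h \<in> iso (rat_ring\<lparr>carrier := S\<rparr>) (R\<lparr>carrier := T\<rparr>)"
    unfolding rng_isomorphic_def by blast
  interpret R: ring R by fact
  interpret T: subrng T R by fact
  define D where "D = carrier (int_monoid_ring n C)"
  have "0 \<in> C"
    using submonoid.one_closed[OF assms(2)] by (simp add: exponent_monoid_def)
  then interpret D: unital_subring D
    unfolding D_def by (rule carrier_int_monoid_subring)
  have S: "diff_mult_closed S"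
    using assms(6) by (simp add: subrng_rat_ring_iff)

  have bij: "bij_betw h S T"
    using h_mult_iso by (simp add: iso_def)
  have h_add: "h (s + t) = h s \<oplus>\<^bsub>R\<^esub> h t" if "s \<in> S" "t \<in> S" for s t
    using h_add_iso that by (simp add: iso_def hom_def ring_of_type_algebra_def)
  have h_mult: "h (s * t) = h s \<otimes>\<^bsub>R\<^esub> h t" if "s \<in> S" "t \<in> S" for s t
    using h_mult_iso that by (simp add: iso_def hom_def ring_of_type_algebra_def)
  have h_T: "h s \<in> T" if "s \<in> S" for s
    using bij_betwE[OF bij] that by blast
  have h_R: "h s \<in> carrier R" if "s \<in> S" for s
    using h_T[OF that] T.a_subset by blast
  note S0 = diff_mult_closed_0[OF S]
  have h_0: "h 0 = \<zero>\<^bsub>R\<^esub>"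
    using h_add[OF S0 S0] R.add.l_cancel_one[OF h_R[OF S0] h_R[OF S0]] by simp
  have h_eq_0: "h s = \<zero>\<^bsub>R\<^esub> \<longleftrightarrow> s = 0" if "s \<in> S" for s
    using inj_on_eq_iff[OF bij_betw_imp_inj_on[OF bij] that S0] h_0 by simp

  obtain \<psi> where \<psi>: "\<psi> \<in> ring_iso (int_monoid_ring n C Quot I) R"
    using assms(5) unfolding is_ring_iso_def by blast
  \<comment> \<open>Everything is pulled back to \<open>D\<close> along this surjection onto
    \<open>R\<close>.\<close>
  define \<phi> where "\<phi> = \<psi> \<circ> (+>\<^bsub>int_monoid_ring n C\<^esub>) I"
  have \<phi>_hom: "\<phi> \<in> ring_hom (int_monoid_ring n C) R"
    unfolding \<phi>_def using \<psi>
    by (intro ring_hom_trans[OF ideal.rcos_ring_hom[OF assms(3)]]) (simp add: ring_iso_def)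
  have \<phi>_R: "\<phi> x \<in> carrier R" if "x \<in> D" for x
    using ring_hom_closed[OF \<phi>_hom] that by (simp add: D_def)
  have \<phi>_mult: "\<phi> (x * y) = \<phi> x \<otimes>\<^bsub>R\<^esub> \<phi> y" if "x \<in> D" "y \<in> D" for x y
    using ring_hom_mult[OF \<phi>_hom, of x y] that by (simp add: D_def int_monoid_ring_simps)
  have \<phi>_add: "\<phi> (x + y) = \<phi> x \<oplus>\<^bsub>R\<^esub> \<phi> y" if "x \<in> D" "y \<in> D" for x y
    using ring_hom_add[OF \<phi>_hom, of x y] that by (simp add: D_def int_monoid_ring_simps)
  have \<phi>_0: "\<phi> 0 = \<zero>\<^bsub>R\<^esub>"
    using \<phi>_add[OF D.zero_mem D.zero_mem] R.add.l_cancel_one[OF \<phi>_R[OF D.zero_mem] \<phi>_R[OF D.zero_mem]]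
    by simp
  have \<phi>_surj: "\<exists>x\<in>D. \<phi> x = r" if "r \<in> carrier R" for r
  proof -
    have "\<psi> ` carrier (int_monoid_ring n C Quot I) = carrier R"
      using \<psi> by (simp add: ring_iso_def bij_betw_def)
    with that have "r \<in> \<psi> ` carrier (int_monoid_ring n C Quot I)"
      by simp
    then obtain c where c: "r = \<psi> c" "c \<in> carrier (int_monoid_ring n C Quot I)"
      by (elim imageE)
    from c(2) obtain x where "x \<in> D" "c = I +>\<^bsub>int_monoid_ring n C\<^esub> x"
      unfolding FactRing_def A_RCOSETS_def' D_def by auto
    then show ?thesis
      using c(1) by (intro bexI[of _ x]) (simp_all add: \<phi>_def)
  qed
  define J where "J = {x \<in> D. \<phi> x = \<zero>\<^bsub>R\<^esub>}"
  have diff_J: "x - y \<in> J" if "x \<in> D" "y \<in> D" "\<phi> x = \<phi> y" for x y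
  proof -
    have xy: "x - y \<in> D"
      by (rule D.diff_mem[OF that(1,2)])
    have "\<phi> y = \<phi> (x - y) \<oplus>\<^bsub>R\<^esub> \<phi> y"
      using \<phi>_add[OF xy that(2)] that(3) by simp
    then have "\<phi> (x - y) = \<zero>\<^bsub>R\<^esub>"
      using R.add.r_cancel_one'[OF \<phi>_R[OF that(2)] \<phi>_R[OF xy]] by simp
    then show ?thesis
      using xy by (simp add: J_def)
  qed
  have J: "ideal_in D J"
    unfolding ideal_in_def
  proof (intro conjI ballI)
    show "J \<subseteq> D" "0 \<in> J"
      using \<phi>_0 D.zero_mem by (auto simp: J_def)
    show "x - y \<in> J" if "x \<in> J" "y \<in> J" for x y
      using that by (intro diff_J) (simp_all add: J_def)
    show "x * y \<in> J" if "x \<in> D" "y \<in> J" for x y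
      using that D.mult_mem \<phi>_mult \<phi>_R by (simp add: J_def)
  qed

  \<comment> \<open>As \<open>T\<close> is a copy of a subring of the rationals, it has no zero
    divisors, so \<open>W\<close> is closed under multiplication.\<close>
  define W where "W = {x \<in> D. \<phi> x \<in> T \<and> \<phi> x \<noteq> \<zero>\<^bsub>R\<^esub>}"
  have WI: "x \<in> W" if "x \<in> D" "s \<in> S" "s \<noteq> 0" "\<phi> x = h s" for x s
    using that h_T h_eq_0 by (simp add: W_def)
  have W_mult: "x * y \<in> W" if "x \<in> W" "y \<in> W" for x y
  proof -
    have "\<phi> x \<in> h ` S" "\<phi> y \<in> h ` S"
      using that unfolding bij_betw_imp_surj_on[OF bij] by (simp_all add: W_def)
    then obtain s t where st: "s \<in> S" "t \<in> S" "\<phi> x = h s" "\<phi> y = h t"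
      by (elim imageE)
    then have "s \<noteq> 0" "t \<noteq> 0" "x \<in> D" "y \<in> D"
      using that h_0 by (auto simp: W_def)
    then show ?thesis
      using st h_mult \<phi>_mult diff_mult_closed_mult[OF S]
      by (intro WI[of _ "s * t"]) (auto intro: D.mult_mem)
  qed
  have W_D: "W \<subseteq> D" and JW: "J \<inter> W = {}"
    by (auto simp: W_def J_def)
  obtain Q where Q: "ideal_in D Q" "J \<subseteq> Q" "Q \<inter> W = {}"
    and Q_prime: "\<forall>x\<in>D. \<forall>y\<in>D. x * y \<in> Q \<longrightarrow> x \<in> Q \<or> y \<in> Q"
    using D.prime_avoiding_exists[OF J W_D _ JW, OF W_mult] by blast
  have Q0: "0 \<in> Q" and Q_diff: "\<And>x y. \<lbrakk>x \<in> Q; y \<in> Q\<rbrakk> \<Longrightarrow> x - y \<in> Q"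
    and Q_mult: "\<And>x y. \<lbrakk>x \<in> D; y \<in> Q\<rbrakk> \<Longrightarrow> x * y \<in> Q"
    using Q(1) unfolding ideal_in_def by blast+

  \<comment> \<open>Unities need not correspond under \<open>h\<close>, so integers are transported
    only as repeated sums.\<close>
  have \<phi>_multiple: "of_nat m * s \<in> S \<and> \<phi> (of_nat m * x) = h (of_nat m * s)"
    if "x \<in> D" "s \<in> S" "\<phi> x = h s" for m x s
  proof (induction m)
    case 0
    then show ?case using S0 h_0 \<phi>_0 by simp
  next
    case (Suc m)
    have "\<phi> (x + of_nat m * x) = h (s + of_nat m * s)"
      using \<phi>_add[OF that(1), of "of_nat m * x"] h_add[OF that(2), of "of_nat m * s"] Suc that
      by (simp add: D.mult_mem D.of_nat_mem)
    moreover have "s + of_nat m * s \<in> S"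
      using diff_mult_closed_add[OF S that(2)] Suc by blast
    ultimately show ?case
      by (simp add: algebra_simps)
  qed
  obtain k :: nat where k: "k > 0" "of_nat k \<in> S"
    and inf: "infinite {p. Factorial_Ring.prime p \<and> of_nat k / of_nat p \<in> S}"
    using infinitely_many_prime_denominators[OF S assms(7)] by (elim exE conjE)
  \<comment> \<open>\<open>e\<close> lifts the image of \<open>k\<close>; a priori it is unrelated
    to the integer \<open>k\<close> of \<open>D\<close>.\<close>
  obtain e where e: "e \<in> D" "\<phi> e = h (of_nat k)"
    using \<phi>_surj[OF h_R[OF k(2)]] by blast
  have eQ: "e \<notin> Q"
    using WI[OF e(1) k(2) _ e(2)] k(1) Q(3) by auto
  have prime: "prime_mod D Q"
  proof
    fix z :: int
    show "of_int z \<in> Q \<longleftrightarrow> z = 0"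
    proof
      assume z: "of_int z \<in> Q"
      show "z = 0"
      proof (rule ccontr)
        assume "z \<noteq> 0"
        \<comment> \<open>Up to sign this element maps to the image of a nonzero multiple of
          \<open>k\<close>, so it lies in \<open>W\<close>.\<close>
        have "e * of_int z \<in> Q"
          by (rule Q_mult[OF e(1) z])
        then have "of_nat (nat \<bar>z\<bar>) * e \<in> Q"
          using Q_diff[OF Q0, of "e * of_int z"] by (cases "z \<ge> 0") (auto simp: mult.commute)
        moreover have "of_nat (nat \<bar>z\<bar>) * e \<in> W"
          using \<phi>_multiple[OF e(1) k(2) e(2), of "nat \<bar>z\<bar>"] \<open>z \<noteq> 0\<close> k(1)
          by (intro WI[of _ "of_nat (nat \<bar>z\<bar>) * of_nat k"]) (auto intro: D.mult_mem D.of_int_mem e)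
        ultimately show False
          using Q(3) by blast
      qed
    qed (use Q0 in simp)
  qed (use Q_diff Q_mult Q_prime in blast)+

  \<comment> \<open>Multiplication by \<open>k\<close> inside \<open>S\<close> is also a
    \<open>k\<close>-fold sum, which makes \<open>e\<close> a root of \<open>X^2 = kX\<close> modulo
    \<open>J\<close>. Since \<open>e\<close> is outside the prime \<open>Q\<close>, it is congruent
    to \<open>k\<close>.\<close>
  have "e * e - of_nat k * e \<in> J"
  proof (rule diff_J)
    show "\<phi> (e * e) = \<phi> (of_nat k * e)"
      using \<phi>_multiple[OF e(1) k(2) e(2), of k] \<phi>_mult[OF e(1) e(1)] h_mult[OF k(2) k(2)] e(2) by simp
  qed (auto intro: D.mult_mem D.of_nat_mem e)
  then have "e * (e - of_nat k) \<in> Q"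
    using Q(2) by (auto simp: algebra_simps)
  then have ek: "e - of_nat k \<in> Q"
    using Q_prime e(1) eQ D.diff_mem D.of_nat_mem by blast
  have "{p. Factorial_Ring.prime p \<and> of_nat k / of_nat p \<in> S}
      \<subseteq> {p. Factorial_Ring.prime p \<and> (\<exists>x\<in>D. of_nat p * x - of_int (int k) \<in> Q)}"
  proof clarify
    fix p :: nat
    assume p: "Factorial_Ring.prime p" and kp: "of_nat k / of_nat p \<in> S"
    \<comment> \<open>The lift of \<open>k / p\<close> is the required quotient: modulo
      \<open>Q\<close>, \<open>p * x\<close> is congruent to \<open>e\<close> and thus to
      \<open>k\<close>.\<close>
    obtain x where x: "x \<in> D" "\<phi> x = h (of_nat k / of_nat p)"
      using \<phi>_surj[OF h_R[OF kp]] by blast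
    have "of_nat p * (of_nat k / of_nat p :: rat) = of_nat k"
      using prime_gt_0_nat[OF p] by simp
    then have "\<phi> (of_nat p * x) = \<phi> e"
      using \<phi>_multiple[OF x(1) kp x(2), of p] e(2) by simp
    then have "of_nat p * x - e \<in> Q"
      using diff_J[of "of_nat p * x" e] x(1) e(1) Q(2) D.mult_mem D.of_nat_mem by blast
    then have "(of_nat p * x - e) - (0 - (e - of_nat k)) \<in> Q"
      using Q_diff[OF _ Q_diff[OF Q0 ek]] by blast
    then show "\<exists>x\<in>D. of_nat p * x - of_int (int k) \<in> Q"
      using x(1) by auto
  qed
  moreover have "finite {p. Factorial_Ring.prime p \<and> (\<exists>x\<in>D. of_nat p * x - of_int (int k) \<in> Q)}"
    unfolding D_def
    by (rule finite_primes_dividing_mod_prime) (use prime k(1) in \<open>simp_all add: D_def\<close>)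
  ultimately show False
    using inf finite_subset by blast
qed

end
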